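(* Let $E,F$ be complex Banach spaces, $U$ an open subset of $E$, and $1<p\leq\infty$. (i) Every Cohen strongly $p$-summing holomorphic mapping $f\colon U\to F$ has relatively weakly compact range. (ii) If $F$ is reflexive, then every Cohen strongly $p$-summing holomorphic mapping $f\colon U\to F$ has relatively compact range.
   Context: With $p^*$ the conjugate index of $p$ ($\infty^*=1$) and $B_X$ the closed unit ball of $X$, a holomorphic $f\colon U\to F$ is Cohen strongly $p$-summing if there is $C\geq0$ such that for all $n\in\mathbb{N}$, $\lambda_i\in\mathbb{C}$, $x_i\in U$, $y_i^*\in F^*$ ($1\le i\le n$), $\sum_{i=1}^n|\lambda_i||\langle y_i^*,f(x_i)\rangle|\leq C\|(\lambda_i)\|_{\ell_p^n}\sup_{y^{**}\in B_{F^{**}}}(\sum_i|y^{**}(y_i^* )|^{p^*})^{1/p^*}$, where $\|(\lambda_i)\|_{\ell_p^n}=(\sum_i|\lambda_i|^p)^{1/p}$ ($\max_i|\lambda_i|$ if $p=\infty$). The range of $f$ is $f(U)\subseteq F$. *)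

theory Defs
  imports "HOL-Analysis.Analysis"
begin

section \<open>Complex Banach spaces\<close>

text \<open>
  HOL-Analysis only provides real normed vector spaces. A complex normed space is a real one
  with a compatible complex scalar multiplication and an absolutely homogeneous norm.
\<close>

class scaleC = scaleR +
  fixes scaleC :: "complex \<Rightarrow> 'a \<Rightarrow> 'a" (infixr "*\<^sub>C" 75)
  assumes scaleR_scaleC: "scaleR r = scaleC (complex_of_real r)"

class complex_vector = scaleC + ab_group_add +
  assumes scaleC_add_right: "a *\<^sub>C (x + y) = a *\<^sub>C x + a *\<^sub>C y"
    and scaleC_add_left: "(a + b) *\<^sub>C x = a *\<^sub>C x + b *\<^sub>C x"
    and scaleC_scaleC: "a *\<^sub>C b *\<^sub>C x = (a * b) *\<^sub>C x"
    and scaleC_one: "1 *\<^sub>C x = x"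

class complex_normed_vector = complex_vector + real_normed_vector +
  assumes norm_scaleC: "norm (a *\<^sub>C x) = cmod a * norm x"

class complex_banach = complex_normed_vector + banach

instantiation complex :: complex_banach
begin

definition scaleC_complex :: "complex \<Rightarrow> complex \<Rightarrow> complex"
  where "scaleC_complex a x = a * x"

instance
  by standard
    (auto simp: scaleC_complex_def fun_eq_iff scaleR_conv_of_real algebra_simps norm_mult)

end

lemma bounded_linear_scaleC_right:
  "bounded_linear (\<lambda>x::'a::complex_normed_vector. a *\<^sub>C x)"
proof (rule bounded_linear_intro[where K = "cmod a"])
  fix r and x y :: 'a
  show "a *\<^sub>C (x + y) = a *\<^sub>C x + a *\<^sub>C y"
    by (rule scaleC_add_right)
  show "a *\<^sub>C r *\<^sub>R x = r *\<^sub>R a *\<^sub>C x"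
    by (simp add: scaleR_scaleC scaleC_scaleC mult.commute)
  show "norm (a *\<^sub>C x) \<le> norm x * cmod a"
    by (simp add: norm_scaleC mult.commute)
qed

section \<open>The dual space\<close>

definition complex_homogeneous ::
    "('a::complex_normed_vector \<Rightarrow> 'b::complex_normed_vector) \<Rightarrow> bool"
  where "complex_homogeneous T \<longleftrightarrow> (\<forall>c x. T (c *\<^sub>C x) = c *\<^sub>C T x)"

text \<open>
  The topological dual: the bounded complex-linear functionals, with the operator norm
  inherited from the type of bounded real-linear maps. The bidual is \<open>'a cdual cdual\<close>.
\<close>

typedef (overloaded) ('a::complex_normed_vector) cdual =
    "{\<phi> :: 'a \<Rightarrow>\<^sub>L complex. complex_homogeneous (blinfun_apply \<phi>)}"
  morphisms blinfun_of_cdual Abs_cdual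
  by (rule exI[of _ 0]) (simp add: complex_homogeneous_def scaleC_complex_def)

setup_lifting type_definition_cdual

lift_definition cdual_apply :: "'a::complex_normed_vector cdual \<Rightarrow> 'a \<Rightarrow> complex"
  is blinfun_apply .

instantiation cdual :: (complex_normed_vector) complex_normed_vector
begin

lift_definition zero_cdual :: "'a cdual" is 0
  by (simp add: complex_homogeneous_def scaleC_complex_def)

lift_definition plus_cdual :: "'a cdual \<Rightarrow> 'a cdual \<Rightarrow> 'a cdual" is "(+)"
  by (simp add: complex_homogeneous_def blinfun.add_left scaleC_add_right)

lift_definition uminus_cdual :: "'a cdual \<Rightarrow> 'a cdual" is uminus
  by (simp add: complex_homogeneous_def blinfun.minus_left scaleC_complex_def)

lift_definition minus_cdual :: "'a cdual \<Rightarrow> 'a cdual \<Rightarrow> 'a cdual" is "(-)"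
  by (simp add: complex_homogeneous_def blinfun.diff_left scaleC_complex_def algebra_simps)

lift_definition scaleR_cdual :: "real \<Rightarrow> 'a cdual \<Rightarrow> 'a cdual" is scaleR
  by (simp add: complex_homogeneous_def blinfun.scaleR_left scaleC_complex_def)

lift_definition scaleC_cdual :: "complex \<Rightarrow> 'a cdual \<Rightarrow> 'a cdual"
  is "\<lambda>c \<phi>. blinfun_mult_right c o\<^sub>L \<phi>"
  by (simp add: complex_homogeneous_def scaleC_complex_def blinfun_mult_right.rep_eq)

lift_definition norm_cdual :: "'a cdual \<Rightarrow> real" is norm .

definition dist_cdual :: "'a cdual \<Rightarrow> 'a cdual \<Rightarrow> real"
  where "dist_cdual \<phi> \<psi> = norm (\<phi> - \<psi>)"

definition sgn_cdual :: "'a cdual \<Rightarrow> 'a cdual"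
  where "sgn_cdual \<phi> = inverse (norm \<phi>) *\<^sub>R \<phi>"

definition uniformity_cdual :: "('a cdual \<times> 'a cdual) filter"
  where "uniformity_cdual = (INF e\<in>{0<..}. principal {(\<phi>, \<psi>). dist \<phi> \<psi> < e})"

definition open_cdual :: "'a cdual set \<Rightarrow> bool"
  where "open_cdual S = (\<forall>\<phi>\<in>S. \<forall>\<^sub>F (\<phi>', \<psi>) in uniformity. \<phi>' = \<phi> \<longrightarrow> \<psi> \<in> S)"

instance
proof
  fix \<phi> \<psi> \<xi> :: "'a cdual" and r s :: real and a b :: complex and S :: "'a cdual set"
  show "\<phi> + \<psi> + \<xi> = \<phi> + (\<psi> + \<xi>)" by transfer simp
  show "\<phi> + \<psi> = \<psi> + \<phi>" by transfer simp
  show "0 + \<phi> = \<phi>" by transfer simp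
  show "- \<phi> + \<phi> = 0" by transfer simp
  show "\<phi> - \<psi> = \<phi> + - \<psi>" by transfer simp
  show "((*\<^sub>R) r :: 'a cdual \<Rightarrow> _) = (*\<^sub>C) (complex_of_real r)"
  proof
    fix \<theta> :: "'a cdual"
    show "r *\<^sub>R \<theta> = complex_of_real r *\<^sub>C \<theta>"
      by transfer (rule blinfun_eqI, simp add: blinfun_mult_right.rep_eq blinfun.scaleR_left scaleR_conv_of_real)
  qed
  show "a *\<^sub>C (\<phi> + \<psi>) = a *\<^sub>C \<phi> + a *\<^sub>C \<psi>"
    by transfer (rule blinfun_eqI, simp add: blinfun_mult_right.rep_eq blinfun.add_left algebra_simps)
  show "(a + b) *\<^sub>C \<phi> = a *\<^sub>C \<phi> + b *\<^sub>C \<phi>"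
    by transfer (rule blinfun_eqI, simp add: blinfun_mult_right.rep_eq blinfun.add_left algebra_simps)
  show "a *\<^sub>C b *\<^sub>C \<phi> = (a * b) *\<^sub>C \<phi>"
    by transfer (rule blinfun_eqI, simp add: blinfun_mult_right.rep_eq)
  show "1 *\<^sub>C \<phi> = \<phi>"
    by transfer (rule blinfun_eqI, simp add: blinfun_mult_right.rep_eq)
  show "r *\<^sub>R (\<phi> + \<psi>) = r *\<^sub>R \<phi> + r *\<^sub>R \<psi>" by transfer (rule scaleR_add_right)
  show "(r + s) *\<^sub>R \<phi> = r *\<^sub>R \<phi> + s *\<^sub>R \<phi>" by transfer (rule scaleR_add_left)
  show "r *\<^sub>R s *\<^sub>R \<phi> = (r * s) *\<^sub>R \<phi>" by transfer simp
  show "1 *\<^sub>R \<phi> = \<phi>" by transfer simp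
  show "dist \<phi> \<psi> = norm (\<phi> - \<psi>)" by (rule dist_cdual_def)
  show "sgn \<phi> = inverse (norm \<phi>) *\<^sub>R \<phi>" by (rule sgn_cdual_def)
  show "(uniformity :: ('a cdual \<times> 'a cdual) filter) =
      (INF e\<in>{0<..}. principal {(\<phi>, \<psi>). dist \<phi> \<psi> < e})"
    by (rule uniformity_cdual_def)
  show "open S = (\<forall>\<phi>\<in>S. \<forall>\<^sub>F (\<phi>', \<psi>) in uniformity. \<phi>' = \<phi> \<longrightarrow> \<psi> \<in> S)"
    by (rule open_cdual_def)
  show "(norm \<phi> = 0) = (\<phi> = 0)" by transfer simp
  show "norm (\<phi> + \<psi>) \<le> norm \<phi> + norm \<psi>" by transfer (rule norm_triangle_ineq)
  show "norm (r *\<^sub>R \<phi>) = \<bar>r\<bar> * norm \<phi>" by transfer simp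
  show "norm (a *\<^sub>C \<phi>) = cmod a * norm \<phi>"
  proof transfer
    fix a and \<theta> :: "'a \<Rightarrow>\<^sub>L complex"
    have *: "norm (blinfun_mult_right c o\<^sub>L \<eta>) \<le> cmod c * norm \<eta>"
      for c and \<eta> :: "'a \<Rightarrow>\<^sub>L complex"
      by (rule norm_blinfun_bound)
        (auto simp: blinfun_mult_right.rep_eq norm_mult mult.assoc intro!: mult_left_mono norm_blinfun)
    show "norm (blinfun_mult_right a o\<^sub>L \<theta>) = cmod a * norm \<theta>"
    proof (cases "a = 0")
      case True
      then show ?thesis using *[of a \<theta>] by simp
    next
      case False
      have "\<theta> = blinfun_mult_right (inverse a) o\<^sub>L (blinfun_mult_right a o\<^sub>L \<theta>)"
        by (rule blinfun_eqI) (simp add: blinfun_mult_right.rep_eq False)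
      then have "norm \<theta> \<le> cmod (inverse a) * norm (blinfun_mult_right a o\<^sub>L \<theta>)"
        using *[of "inverse a" "blinfun_mult_right a o\<^sub>L \<theta>"] by simp
      then have "cmod a * norm \<theta> \<le> norm (blinfun_mult_right a o\<^sub>L \<theta>)"
        using False by (simp add: norm_inverse norm_divide field_simps)
      then show ?thesis using *[of a \<theta>] by simp
    qed
  qed
qed

end

lemma cdual_apply_add: "cdual_apply (\<phi> + \<psi>) x = cdual_apply \<phi> x + cdual_apply \<psi> x"
  by transfer (rule blinfun.add_left)

lemma cdual_apply_scaleR: "cdual_apply (r *\<^sub>R \<phi>) x = r *\<^sub>R cdual_apply \<phi> x"
  by transfer (rule blinfun.scaleR_left)

lemma cdual_apply_scaleC: "cdual_apply (c *\<^sub>C \<phi>) x = c * cdual_apply \<phi> x"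
  by transfer (simp add: blinfun_mult_right.rep_eq)

lemma norm_cdual_apply_le: "cmod (cdual_apply \<phi> x) \<le> norm \<phi> * norm x"
  by transfer (rule norm_blinfun)

lemma norm_cdual_eq_onorm: "norm \<phi> = onorm (cdual_apply \<phi>)"
  by transfer (rule norm_blinfun.rep_eq)

lemma bounded_linear_cdual_apply_left: "bounded_linear (\<lambda>\<phi>. cdual_apply \<phi> x)"
  by (rule bounded_linear_intro[where K = "norm x"])
    (auto simp: cdual_apply_add cdual_apply_scaleR norm_cdual_apply_le)

lift_definition bidual_embedding :: "'a::complex_normed_vector \<Rightarrow> 'a cdual cdual"
  is "\<lambda>x. Blinfun (\<lambda>\<phi>. cdual_apply \<phi> x)"
  by (simp add: complex_homogeneous_def bounded_linear_Blinfun_apply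
      bounded_linear_cdual_apply_left cdual_apply_scaleC scaleC_complex_def)

lemma bidual_embedding_apply: "cdual_apply (bidual_embedding x) \<phi> = cdual_apply \<phi> x"
  unfolding cdual_apply.rep_eq[of "bidual_embedding x"] bidual_embedding.rep_eq
  by (simp add: bounded_linear_Blinfun_apply bounded_linear_cdual_apply_left)

definition reflexive_space :: "'a::complex_normed_vector itself \<Rightarrow> bool"
  where "reflexive_space _ \<longleftrightarrow> surj (bidual_embedding :: 'a \<Rightarrow> 'a cdual cdual)"

section \<open>Weak topology and relative compactness\<close>

definition weak_topology :: "'a::complex_normed_vector topology"
  where "weak_topology = topology_generated_by {cdual_apply \<phi> -` V | \<phi> V. open V}"

definition relatively_weakly_compact :: "'a::complex_normed_vector set \<Rightarrow> bool"
  where "relatively_weakly_compact S \<longleftrightarrow> compactin weak_topology (weak_topology closure_of S)"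

definition relatively_compact :: "'a::topological_space set \<Rightarrow> bool"
  where "relatively_compact S \<longleftrightarrow> compact (closure S)"

section \<open>Cohen strongly summing holomorphic mappings\<close>

text \<open>
  Holomorphy on an open set: complex Frechet differentiability at every point. As
  \<open>has_derivative\<close> supplies a bounded real-linear derivative, only complex homogeneity is added.
\<close>

definition holomorphic_map_on ::
    "('a::complex_normed_vector \<Rightarrow> 'b::complex_normed_vector) \<Rightarrow> 'a set \<Rightarrow> bool"
  where "holomorphic_map_on f U \<longleftrightarrow>
    (\<forall>a\<in>U. \<exists>D. (f has_derivative D) (at a) \<and> complex_homogeneous D)"

text \<open>Exponents range over \<open>1 < p \<le> \<infinity>\<close>, so that the conjugate exponent is a real number.\<close>

definition conjugate_exponent :: "ereal \<Rightarrow> real"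
  where "conjugate_exponent p =
    (if p = \<infinity> then 1 else real_of_ereal p / (real_of_ereal p - 1))"

definition lp_norm :: "ereal \<Rightarrow> nat \<Rightarrow> (nat \<Rightarrow> complex) \<Rightarrow> real"
  where "lp_norm p n \<alpha> =
    (if p = \<infinity> then Max ((\<lambda>i. cmod (\<alpha> i)) ` {1..n})
     else (\<Sum>i=1..n. cmod (\<alpha> i) powr real_of_ereal p) powr (1 / real_of_ereal p))"

definition weak_lp_norm :: "real \<Rightarrow> nat \<Rightarrow> (nat \<Rightarrow> 'a::complex_normed_vector cdual) \<Rightarrow> real"
  where "weak_lp_norm q n y =
    (SUP \<eta>\<in>cball (0 :: 'a cdual cdual) 1.
       (\<Sum>i=1..n. cmod (cdual_apply \<eta> (y i)) powr q) powr (1 / q))"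

text \<open>The supremum is over a bounded nonempty set, so it is a genuine supremum in the reals.\<close>

lemma bdd_above_weak_lp_norm:
  fixes y :: "nat \<Rightarrow> 'a::complex_normed_vector cdual"
  assumes "q > 0"
  shows "bdd_above ((\<lambda>\<eta>. (\<Sum>i=1..n. cmod (cdual_apply \<eta> (y i)) powr q) powr (1 / q)) `
    cball (0 :: 'a cdual cdual) 1)"
proof (rule bdd_aboveI2)
  fix \<eta> :: "'a cdual cdual"
  assume "\<eta> \<in> cball 0 1"
  then have "norm \<eta> \<le> 1" by (simp add: dist_norm)
  have "cmod (cdual_apply \<eta> (y i)) \<le> norm (y i)" for i
    using norm_cdual_apply_le[of \<eta> "y i"] mult_right_mono[OF \<open>norm \<eta> \<le> 1\<close>, of "norm (y i)"]
    by simp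
  then show "(\<Sum>i=1..n. cmod (cdual_apply \<eta> (y i)) powr q) powr (1 / q) \<le>
      (\<Sum>i=1..n. norm (y i) powr q) powr (1 / q)"
    using assms by (intro powr_mono2 sum_mono sum_nonneg) auto
qed

definition cohen_strongly_summing ::
    "ereal \<Rightarrow> ('a::complex_normed_vector \<Rightarrow> 'b::complex_normed_vector) \<Rightarrow> 'a set \<Rightarrow> bool"
  where "cohen_strongly_summing p f U \<longleftrightarrow>
    (\<exists>C\<ge>0. \<forall>n\<ge>1. \<forall>(\<alpha> :: nat \<Rightarrow> complex) (x :: nat \<Rightarrow> 'a) (y :: nat \<Rightarrow> 'b cdual).
       (\<forall>i\<in>{1..n}. x i \<in> U) \<longrightarrow>
       (\<Sum>i=1..n. cmod (\<alpha> i) * cmod (cdual_apply (y i) (f (x i)))) \<le>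
         C * lp_norm p n \<alpha> * weak_lp_norm (conjugate_exponent p) n y)"

end

theory Submission
  imports Defs "HOL-Complex_Analysis.Great_Picard"
begin

text \<open>
  Write \<open>S = f ` U\<close> and let \<open>q\<close> be the conjugate exponent of \<open>p\<close>. Choosing the scalars in the
  Cohen inequality well turns it into a statement about \<open>S\<close> alone: for finitely many points
  \<open>s\<^sub>i\<close> of \<open>S\<close>, functionals \<open>z\<^sub>i\<close> and weights \<open>w\<^sub>i\<close> of sum \<open>1\<close>, the weighted mean of
  \<open>\<bar>z\<^sub>i s\<^sub>i\<bar>\<close> is at most \<open>C\<close> times the supremum over the bidual ball of the weighted \<open>q\<close>-means
  of \<open>\<bar>\<eta> z\<^sub>i\<bar>\<close>. For functionals of norm at most \<open>2\<close> a small quadratic mean forces a small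
  \<open>q\<close>-mean, so every exponent can be replaced by \<open>2\<close> (\<open>cohen_mean_square_lower_bound\<close>):
  functionals \<open>z\<^sub>i\<close> that are bounded away from \<open>0\<close> at points \<open>s\<^sub>i\<close> of \<open>S\<close> cannot have
  \<open>\<Sum>i. w\<^sub>i \<bar>\<eta> z\<^sub>i\<bar>\<^sup>2\<close> uniformly small in \<open>\<eta>\<close>. Both parts contradict this by exhibiting such
  functionals. This replaces the usual argument through Pietsch domination, an \<open>L\<^sub>q\<close> space and
  the transposed operator. The metric statements about the dual all come from one form of the
  Hahn-Banach theorem, \<open>mazur_orlicz\<close>.

  Weak compactness. The set \<open>S\<close> is bounded, so its weak-star closure in the bidual is compact,
  and it has to be shown that every \<open>\<psi>\<close> in it belongs to the space. Otherwise Helly's theorem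
  (\<open>helly_outside_space\<close>) and the approximation of \<open>\<psi>\<close> by points of \<open>S\<close> give functionals \<open>y\<^sub>j\<close>
  in the unit ball and points \<open>s\<^sub>n\<close> of \<open>S\<close> with \<open>Re (y\<^sub>j s\<^sub>n) \<ge> \<theta>\<close> for \<open>j \<le> n\<close> and
  \<open>y\<^sub>j s\<^sub>n = 0\<close> for \<open>j > n\<close>. Cut \<open>{0..<2\<^sup>K}\<close> into dyadic intervals and let \<open>z\<close> run through the
  differences between the mean of the \<open>y\<^sub>j\<close> over the left half of an interval and the mean
  over the right half. Evaluated at the point whose index ends the left half, \<open>z\<close> has real
  part at least \<open>\<theta>\<close>. For fixed \<open>\<eta>\<close> the numbers \<open>\<eta> z\<close> are martingale differences of the bounded
  sequence \<open>\<eta> y\<^sub>j\<close>; their total energy over all \<open>K\<close> levels is at most \<open>4\<close>, so the mean over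
  levels is at most \<open>4 / K\<close>.

  Compactness. If \<open>S\<close> is not relatively compact, there are \<open>y\<^sub>n\<close> in the dual ball such that
  any two differ by at least \<open>\<delta>\<close> somewhere on \<open>S\<close>. As the space is reflexive, a subsequence
  converges weakly, and the differences \<open>z\<^sub>k\<close> of its successive terms are weakly null without
  being small on \<open>S\<close>. The functions \<open>\<eta> \<mapsto> \<bar>\<eta> z\<^sub>k\<bar>\<^sup>2\<close> on the weak-star compact bidual ball are
  continuous, bounded and pointwise null, hence some convex combination of them is uniformly
  small (\<open>pointwise_null_convex_combination\<close>).
\<close>

section \<open>Linear functionals below a sublinear one\<close>

definition sublinear :: "('a::real_vector \<Rightarrow> real) \<Rightarrow> bool"
  where "sublinear p \<longleftrightarrow>
    (\<forall>x y. p (x + y) \<le> p x + p y) \<and> (\<forall>c\<ge>0. \<forall>x. p (c *\<^sub>R x) = c * p x)"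

lemma sublinearD:
  assumes "sublinear p"
  shows "p (x + y) \<le> p x + p y" and "0 \<le> c \<Longrightarrow> p (c *\<^sub>R x) = c * p x"
    and "p 0 = 0" and "- p (- x) \<le> p x"
proof -
  show "p (x + y) \<le> p x + p y" for x y
    using assms by (simp add: sublinear_def)
  then have *: "p (x + - x) \<le> p x + p (- x)" .
  show scale: "p (c *\<^sub>R x) = c * p x" if "0 \<le> c" for c x
    using assms that by (simp add: sublinear_def)
  show "p 0 = 0"
    using scale[of 0 0] by simp
  then show "- p (- x) \<le> p x"
    using * by simp
qed

text \<open>
  The infimum of \<open>p (x + w) - r\<close> over the cone is the largest sublinear functional below \<open>p\<close>
  that satisfies the last condition; it is finite because \<open>r \<le> p w\<close> bounds the infimum from
  below by \<open>- p (- x)\<close>. A cone of pairs treats several constructions at once: a ray gives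
  linearity of minimal functionals, the graph of a functional on a subspace gives extensions,
  and the cone over a convex set gives functionals that are large on this set.
\<close>

lemma sublinear_inf_along_cone:
  fixes p :: "'a::real_vector \<Rightarrow> real" and C :: "('a \<times> real) set"
  assumes p: "sublinear p" and C: "convex_cone C" and le: "\<And>w r. (w, r) \<in> C \<Longrightarrow> r \<le> p w"
  obtains q where "sublinear q" "\<And>x. q x \<le> p x" "\<And>w r. (w, r) \<in> C \<Longrightarrow> q (- w) \<le> - r"
proof -
  define h where "h x z = p (x + fst z) - snd z" for x and z :: "'a \<times> real"
  define q where "q x = (INF z\<in>C. h x z)" for x
  have zero: "(0, 0) \<in> C"
    using C convex_cone_contains_0 by (metis zero_prod_def)
  then have ne: "C \<noteq> {}"
    by blast
  have lower: "- p (- x) \<le> h x z" if "z \<in> C" for x z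
  proof -
    have "snd z \<le> p ((x + fst z) + - x)"
      using le[of "fst z" "snd z"] that by simp
    also have "\<dots> \<le> p (x + fst z) + p (- x)"
      by (rule sublinearD[OF p])
    finally show ?thesis
      by (simp add: h_def)
  qed
  have bdd: "bdd_below (h x ` C)" for x
    using lower by (rule bdd_belowI2)
  have q_le: "q x \<le> h x z" if "z \<in> C" for x z
    unfolding q_def using bdd that by (rule cINF_lower)
  have q_ge: "a \<le> q x" if "\<And>z. z \<in> C \<Longrightarrow> a \<le> h x z" for a x
    unfolding q_def using ne that by (rule cINF_greatest)
  have q_p: "q x \<le> p x" for x
    using q_le[OF zero, of x] by (simp add: h_def)
  have "q (x + y) \<le> q x + q y" for x y
  proof -
    have "q (x + y) - h x z \<le> q y" if z: "z \<in> C" for z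
    proof (rule q_ge)
      fix z' assume z': "z' \<in> C"
      have "q (x + y) \<le> h (x + y) (z + z')"
        using q_le convex_cone_add[OF C z z'] by blast
      also have "\<dots> \<le> h x z + h y z'"
        using sublinearD(1)[OF p, of "x + fst z" "y + fst z'"] by (simp add: h_def algebra_simps)
      finally show "q (x + y) - h x z \<le> h y z'"
        by simp
    qed
    then have "q (x + y) - q y \<le> q x"
      by (intro q_ge) (simp add: algebra_simps)
    then show ?thesis
      by simp
  qed
  moreover have "q (c *\<^sub>R x) = c * q x" if "0 \<le> c" for c x
  proof (cases "c = 0")
    case True
    have "- p (- 0) \<le> q 0"
      using lower by (rule q_ge)
    then show ?thesis
      using True q_p[of 0] sublinearD(3)[OF p] by simp
  next
    case False
    have scale: "q (d *\<^sub>R y) \<le> d * q y" if "0 < d" for d y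
    proof -
      have "q (d *\<^sub>R y) / d \<le> q y"
      proof (rule q_ge)
        fix z assume "z \<in> C"
        then have "d *\<^sub>R z \<in> C"
          using C that by (simp add: convex_cone_scaleR)
        then have "q (d *\<^sub>R y) \<le> h (d *\<^sub>R y) (d *\<^sub>R z)"
          by (rule q_le)
        also have "\<dots> = d * h y z"
          using sublinearD(2)[OF p, of d "y + fst z"] that
          by (simp add: h_def algebra_simps scaleR_add_right)
        finally show "q (d *\<^sub>R y) / d \<le> h y z"
          using that by (simp add: field_simps)
      qed
      then show ?thesis
        using that by (simp add: field_simps)
    qed
    have "0 < c"
      using that False by simp
    have "c * q x = c * q (inverse c *\<^sub>R c *\<^sub>R x)"
      using \<open>0 < c\<close> by simp
    also have "\<dots> \<le> c * (inverse c * q (c *\<^sub>R x))"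
      using scale[of "inverse c" "c *\<^sub>R x"] \<open>0 < c\<close> by (intro mult_left_mono) auto
    also have "\<dots> = q (c *\<^sub>R x)"
      using \<open>0 < c\<close> by simp
    finally show ?thesis
      using scale[OF \<open>0 < c\<close>, of x] by simp
  qed
  ultimately have "sublinear q"
    by (simp add: sublinear_def)
  moreover have "q (- w) \<le> - r" if "(w, r) \<in> C" for w r
    using q_le[OF that, of "- w"] sublinearD(3)[OF p] by (simp add: h_def)
  ultimately show thesis
    using q_p that by blast
qed

lemma convex_cone_ray: "convex_cone ((\<lambda>t. t *\<^sub>R v) ` {0..})"
  unfolding convex_cone_iff
proof (intro conjI ballI allI impI)
  show "0 \<in> (\<lambda>t. t *\<^sub>R v) ` {0..}"
    by (rule image_eqI[of _ _ 0]) auto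
next
  fix x y assume "x \<in> (\<lambda>t. t *\<^sub>R v) ` {0..}" "y \<in> (\<lambda>t. t *\<^sub>R v) ` {0..}"
  then obtain s t where "0 \<le> s" "x = s *\<^sub>R v" "0 \<le> t" "y = t *\<^sub>R v"
    by auto
  then show "x + y \<in> (\<lambda>t. t *\<^sub>R v) ` {0..}"
    by (intro image_eqI[of _ _ "s + t"]) (auto simp: scaleR_add_left)
next
  fix x and c :: real assume "x \<in> (\<lambda>t. t *\<^sub>R v) ` {0..}" "0 \<le> c"
  then obtain t where "0 \<le> t" "x = t *\<^sub>R v"
    by auto
  then show "c *\<^sub>R x \<in> (\<lambda>t. t *\<^sub>R v) ` {0..}"
    using \<open>0 \<le> c\<close> by (intro image_eqI[of _ _ "c * t"]) auto
qed

text \<open>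
  By Zorn's lemma: the pointwise infimum of a chain of sublinear functionals is sublinear, and
  is finite since \<open>- p (- x)\<close> is a common lower bound.
\<close>

lemma minimal_sublinear_exists:
  fixes p :: "'a::real_vector \<Rightarrow> real"
  assumes p: "sublinear p"
  obtains m where "sublinear m" "\<And>x. m x \<le> p x"
    "\<And>q. sublinear q \<Longrightarrow> (\<And>x. q x \<le> m x) \<Longrightarrow> q = m"
proof -
  define A where "A = {q. sublinear q \<and> (\<forall>x. q x \<le> p x)}"
  define P where "P q r \<longleftrightarrow> (\<forall>x. r x \<le> q x)" for q r :: "'a \<Rightarrow> real"
  have "\<exists>m\<in>A. \<forall>a\<in>A. P m a \<longrightarrow> a = m"
  proof (rule predicate_Zorn)
    show "partial_order_on A (relation_of P A)"
      by (auto simp: partial_order_on_def preorder_on_def refl_on_def trans_def antisym_def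
          relation_of_def P_def fun_eq_iff intro: order_trans antisym)
  next
    fix D assume D: "D \<in> Chains (relation_of P A)"
    show "\<exists>u\<in>A. \<forall>a\<in>D. P a u"
    proof (cases "D = {}")
      case True
      then show ?thesis
        using p by (auto simp: A_def)
    next
      case False
      have D_A: "q \<in> A" if "q \<in> D" for q
        using D that by (auto simp: Chains_def relation_of_def)
      have total: "(\<forall>x. q x \<le> r x) \<or> (\<forall>x. r x \<le> q x)" if "q \<in> D" "r \<in> D" for q r
        using D that by (auto simp: Chains_def relation_of_def P_def)
      define u where "u x = (INF q\<in>D. q x)" for x
      have "- p (- x) \<le> q x" if "q \<in> D" for q x
      proof -
        have "- q (- x) \<le> q x" "q (- x) \<le> p (- x)"
          using D_A[OF that] by (auto simp: A_def sublinearD(4))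
        then show ?thesis
          by linarith
      qed
      then have bdd: "bdd_below ((\<lambda>q. q x) ` D)" for x
        by (rule bdd_belowI2)
      have u_le: "u x \<le> q x" if "q \<in> D" for q x
        unfolding u_def using bdd that by (rule cINF_lower)
      have u_ge: "a \<le> u x" if "\<And>q. q \<in> D \<Longrightarrow> a \<le> q x" for a x
        unfolding u_def using False that by (rule cINF_greatest)
      have "u (x + y) \<le> u x + u y" for x y
      proof -
        have "u (x + y) - q x \<le> u y" if q: "q \<in> D" for q
        proof (rule u_ge)
          fix r assume r: "r \<in> D"
          have "u (x + y) \<le> q x + r y"
            using total[OF q r]
          proof
            assume "\<forall>x. q x \<le> r x"
            then have "q (x + y) \<le> q x + r y"
              using sublinearD(1)[of q x y] D_A[OF q] by (fastforce simp: A_def intro: order_trans)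
            then show ?thesis
              using u_le[OF q, of "x + y"] by simp
          next
            assume "\<forall>x. r x \<le> q x"
            then have "r (x + y) \<le> q x + r y"
              using sublinearD(1)[of r x y] D_A[OF r] by (fastforce simp: A_def intro: order_trans)
            then show ?thesis
              using u_le[OF r, of "x + y"] by simp
          qed
          then show "u (x + y) - q x \<le> r y"
            by simp
        qed
        then have "u (x + y) - u y \<le> u x"
          by (intro u_ge) (simp add: algebra_simps)
        then show ?thesis
          by simp
      qed
      moreover have "u (c *\<^sub>R x) = c * u x" if "0 \<le> c" for c x
      proof -
        have eq: "q (c *\<^sub>R x) = c * q x" if "q \<in> D" for q
          using D_A[OF that] \<open>0 \<le> c\<close> by (simp add: A_def sublinearD(2))
        have "c * u x \<le> u (c *\<^sub>R x)"
        proof (rule u_ge)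
          fix q assume "q \<in> D"
          then show "c * u x \<le> q (c *\<^sub>R x)"
            using mult_left_mono[OF u_le \<open>0 \<le> c\<close>] eq by metis
        qed
        moreover have "u (c *\<^sub>R x) \<le> c * u x"
        proof (cases "c = 0")
          case True
          obtain q where "q \<in> D"
            using False by blast
          then have "u (c *\<^sub>R x) \<le> c * q x"
            using u_le[of q "c *\<^sub>R x"] eq by simp
          then show ?thesis
            using True by simp
        next
          case c: False
          then have "u (c *\<^sub>R x) / c \<le> u x"
            using u_le[of _ "c *\<^sub>R x"] eq \<open>0 \<le> c\<close> by (intro u_ge) (simp add: field_simps)
          then show ?thesis
            using c \<open>0 \<le> c\<close> by (simp add: field_simps)
        qed
        ultimately show ?thesis
          by simp
      qed
      ultimately have "sublinear u"
        by (simp add: sublinear_def)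
      moreover have "u x \<le> p x" for x
        using False u_le D_A by (fastforce simp: A_def intro: order_trans)
      ultimately have "u \<in> A"
        by (simp add: A_def)
      then show ?thesis
        using u_le by (auto simp: P_def)
    qed
  qed
  then obtain m where m: "m \<in> A" "\<And>a. a \<in> A \<Longrightarrow> P m a \<Longrightarrow> a = m"
    by blast
  have "q = m" if "sublinear q" "\<And>x. q x \<le> m x" for q
    using that m by (intro m(2)) (auto simp: A_def P_def intro: order_trans)
  then show thesis
    using that m(1) by (auto simp: A_def)
qed

text \<open>
  A minimal sublinear \<open>m\<close> is linear: lowering it along the ray through \<open>(a, m a)\<close> changes
  nothing, and this says \<open>m (- a) \<le> - m a\<close>.
\<close>

lemma linear_below_sublinear:
  fixes p :: "'a::real_vector \<Rightarrow> real"
  assumes p: "sublinear p"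
  obtains L where "linear L" "\<And>x. L x \<le> p x"
proof -
  obtain m where m: "sublinear m" "\<And>x. m x \<le> p x"
      and minimal: "\<And>q. sublinear q \<Longrightarrow> (\<And>x. q x \<le> m x) \<Longrightarrow> q = m"
    using minimal_sublinear_exists[OF p] by metis
  have neg: "m (- a) = - m a" for a
  proof -
    define C where "C = (\<lambda>t. t *\<^sub>R (a, m a)) ` {0..}"
    have "convex_cone C"
      unfolding C_def by (rule convex_cone_ray)
    moreover have "r \<le> m w" if "(w, r) \<in> C" for w r
      using that m(1) by (auto simp: C_def sublinearD(2))
    ultimately obtain q where q: "sublinear q" "\<And>x. q x \<le> m x"
        "\<And>w r. (w, r) \<in> C \<Longrightarrow> q (- w) \<le> - r"
      using sublinear_inf_along_cone[OF m(1)] by metis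
    have "(a, m a) \<in> C"
      unfolding C_def by (intro image_eqI[of _ _ 1]) auto
    then have "m (- a) \<le> - m a"
      using q(3) minimal[OF q(1,2)] by metis
    then show ?thesis
      using sublinearD(4)[OF m(1), of a] by simp
  qed
  have "linear m"
  proof (rule linearI)
    fix x y
    have "m (x + y) \<le> m x + m y" "m (- x + - y) \<le> m (- x) + m (- y)"
      by (rule sublinearD[OF m(1)])+
    then show "m (x + y) = m x + m y"
      using neg[of "x + y"] neg[of x] neg[of y] by simp
  next
    fix c x
    show "m (c *\<^sub>R x) = c *\<^sub>R m x"
    proof (cases "0 \<le> c")
      case True
      then show ?thesis
        by (simp add: sublinearD(2)[OF m(1)])
    next
      case False
      then show ?thesis
        using sublinearD(2)[OF m(1), of "- c" x] neg[of "c *\<^sub>R x"] by simp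
    qed
  qed
  then show thesis
    using m(2) that by blast
qed

text \<open>
  The Mazur-Orlicz form of the Hahn-Banach theorem.
\<close>

lemma mazur_orlicz:
  fixes p :: "'a::real_vector \<Rightarrow> real" and C :: "('a \<times> real) set"
  assumes "sublinear p" and "convex_cone C" and "\<And>w r. (w, r) \<in> C \<Longrightarrow> r \<le> p w"
  obtains L where "linear L" "\<And>x. L x \<le> p x" "\<And>w r. (w, r) \<in> C \<Longrightarrow> r \<le> L w"
proof -
  obtain q where q: "sublinear q" "\<And>x. q x \<le> p x" "\<And>w r. (w, r) \<in> C \<Longrightarrow> q (- w) \<le> - r"
    using sublinear_inf_along_cone[OF assms] by metis
  obtain L where L: "linear L" "\<And>x. L x \<le> q x"
    using linear_below_sublinear[OF q(1)] by metis
  have "r \<le> L w" if "(w, r) \<in> C" for w r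
    using L(2)[of "- w"] q(3)[OF that] linear_neg[OF L(1), of w] by simp
  moreover have "L x \<le> p x" for x
    using L(2) q(2) order_trans by blast
  ultimately show thesis
    using L(1) that by blast
qed

section \<open>The dual of a complex normed space\<close>

lemma cdual_eqI: "(\<And>x. cdual_apply \<phi> x = cdual_apply \<psi> x) \<Longrightarrow> \<phi> = \<psi>"
  by transfer (rule blinfun_eqI)

lemma cdual_apply_zero: "cdual_apply 0 x = 0"
  by transfer simp

lemma cdual_apply_minus: "cdual_apply (\<phi> - \<psi>) x = cdual_apply \<phi> x - cdual_apply \<psi> x"
  by transfer (rule blinfun.diff_left)

lemma bounded_linear_cdual_apply: "bounded_linear (cdual_apply \<phi>)"
  by transfer (rule blinfun.bounded_linear_right)

lemmas linear_cdual_apply = bounded_linear.linear[OF bounded_linear_cdual_apply]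

lemma cdual_apply_scaleC_right: "cdual_apply \<phi> (c *\<^sub>C x) = c * cdual_apply \<phi> x"
  by transfer (simp add: complex_homogeneous_def scaleC_complex_def)

lemma norm_cdual_apply_le_of_norm_le_1: "norm \<phi> \<le> 1 \<Longrightarrow> cmod (cdual_apply \<phi> x) \<le> norm x"
  using norm_cdual_apply_le[of \<phi> x] mult_right_mono[of "norm \<phi>" 1 "norm x"] by simp

lemma norm_cdual_le:
  assumes "0 \<le> K" and "\<And>x. cmod (cdual_apply \<phi> x) \<le> K * norm x"
  shows "norm \<phi> \<le> K"
  using assms by transfer (rule norm_blinfun_bound)

lemma cdual_of_functional:
  fixes T :: "'a::complex_normed_vector \<Rightarrow> complex"
  assumes add: "\<And>x y. T (x + y) = T x + T y" and scale: "\<And>c x. T (c *\<^sub>C x) = c * T x"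
    and "0 \<le> K" and bound: "\<And>x. cmod (T x) \<le> K * norm x"
  obtains \<phi> where "cdual_apply \<phi> = T" "norm \<phi> \<le> K"
proof -
  have T: "bounded_linear T"
    using bound
    by (intro bounded_linear_intro[where K = K])
      (simp_all add: add scale scaleR_scaleC scaleC_complex_def mult.commute)
  define \<phi> where "\<phi> = Abs_cdual (Blinfun T)"
  have "complex_homogeneous (blinfun_apply (Blinfun T))"
    using T by (simp add: complex_homogeneous_def bounded_linear_Blinfun_apply scale scaleC_complex_def)
  then have "cdual_apply \<phi> = T"
    using T by (simp add: \<phi>_def cdual_apply.rep_eq Abs_cdual_inverse bounded_linear_Blinfun_apply)
  moreover from this have "norm \<phi> \<le> K"
    using bound \<open>0 \<le> K\<close> by (intro norm_cdual_le) simp_all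
  ultimately show thesis
    using that by blast
qed

text \<open>
  The complex functional is \<open>x \<mapsto> L x - \<i> L (\<i> x)\<close>. Rotating \<open>x\<close> so that the value becomes real
  and nonnegative shows that the bound on \<open>L\<close> is inherited by the modulus.
\<close>

lemma cdual_with_real_part:
  fixes L :: "'a::complex_normed_vector \<Rightarrow> real"
  assumes L: "linear L" and "0 \<le> K" and bound: "\<And>x. L x \<le> K * norm x"
  obtains \<phi> where "\<And>x. Re (cdual_apply \<phi> x) = L x" "norm \<phi> \<le> K"
proof -
  define T where "T x = Complex (L x) (- L (\<i> *\<^sub>C x))" for x
  have L_add: "L (x + y) = L x + L y" for x y
    using L by (rule linear_add)
  have L_scaleR: "L (of_real r *\<^sub>C x) = r * L x" for r x
    using linear_cmul[OF L, of r x] by (simp add: scaleR_scaleC)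
  have L_neg: "L (\<i> *\<^sub>C \<i> *\<^sub>C x) = - L x" for x
    using L_scaleR[of "-1" x] by (simp add: scaleC_scaleC)
  have add: "T (x + y) = T x + T y" for x y
    by (simp add: T_def complex_eq_iff scaleC_add_right L_add)
  have scale: "T (c *\<^sub>C x) = c * T x" for c x
  proof -
    have "c *\<^sub>C x = of_real (Re c) *\<^sub>C x + of_real (Im c) *\<^sub>C \<i> *\<^sub>C x"
      by (simp add: scaleC_scaleC flip: scaleC_add_left) (metis complex_eq mult.commute)
    then have *: "T (c *\<^sub>C x) = T (of_real (Re c) *\<^sub>C x) + T (of_real (Im c) *\<^sub>C \<i> *\<^sub>C x)"
      by (simp add: add)
    have "\<i> *\<^sub>C of_real r *\<^sub>C y = of_real r *\<^sub>C \<i> *\<^sub>C y" for r and y :: 'a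
      by (simp add: scaleC_scaleC mult.commute)
    then show ?thesis
      unfolding * by (simp add: T_def complex_eq_iff L_scaleR L_neg)
  qed
  have "cmod (T x) \<le> K * norm x" for x
  proof (cases "T x = 0")
    case True
    then show ?thesis
      using \<open>0 \<le> K\<close> by simp
  next
    case False
    define c where "c = cnj (T x) / cmod (T x)"
    have "cmod c = 1"
      using False by (simp add: c_def norm_divide)
    have "T (c *\<^sub>C x) = of_real (cmod (T x))"
      using False unfolding scale c_def
      by (simp add: complex_norm_square[symmetric] mult.commute power2_eq_square field_simps)
    then have "cmod (T x) = L (c *\<^sub>C x)"
      by (simp add: T_def complex_eq_iff)
    also have "\<dots> \<le> K * norm x"
      using bound[of "c *\<^sub>C x"] \<open>cmod c = 1\<close> by (simp add: norm_scaleC)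
    finally show ?thesis .
  qed
  then obtain \<phi> where "cdual_apply \<phi> = T" "norm \<phi> \<le> K"
    using cdual_of_functional[OF add scale \<open>0 \<le> K\<close>] by metis
  then show thesis
    by (intro that[of \<phi>]) (simp_all add: T_def)
qed

lemma sublinear_norm: "0 \<le> K \<Longrightarrow> sublinear (\<lambda>x. K * norm x)"
  by (auto simp: sublinear_def simp flip: distrib_left intro!: mult_left_mono norm_triangle_ineq)

lemma norming_functional:
  fixes x :: "'a::complex_normed_vector"
  obtains \<phi> where "norm \<phi> \<le> 1" "Re (cdual_apply \<phi> x) = norm x"
proof -
  define C where "C = (\<lambda>t. t *\<^sub>R (x, norm x)) ` {0..}"
  have "convex_cone C"
    unfolding C_def by (rule convex_cone_ray)
  moreover have "r \<le> 1 * norm w" if "(w, r) \<in> C" for w r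
    using that by (auto simp: C_def)
  ultimately obtain L where L: "linear L" "\<And>y. L y \<le> 1 * norm y" "\<And>w r. (w, r) \<in> C \<Longrightarrow> r \<le> L w"
    using mazur_orlicz[OF sublinear_norm[of 1]] by (metis zero_le_one)
  have "(x, norm x) \<in> C"
    unfolding C_def by (intro image_eqI[of _ _ 1]) auto
  then have "L x = norm x"
    using L(2)[of x] L(3) by fastforce
  then show thesis
    using cdual_with_real_part[OF L(1) _ L(2)] that by (metis zero_le_one)
qed

lemma norm_le_if_functionals_le:
  fixes x :: "'a::complex_normed_vector"
  assumes "\<And>\<phi>. norm \<phi> \<le> 1 \<Longrightarrow> cmod (cdual_apply \<phi> x) \<le> a"
  shows "norm x \<le> a"
proof -
  obtain \<phi> where \<phi>: "norm \<phi> \<le> 1" "Re (cdual_apply \<phi> x) = norm x"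
    by (rule norming_functional)
  then have "norm x \<le> cmod (cdual_apply \<phi> x)"
    using complex_Re_le_cmod by metis
  also have "\<dots> \<le> a"
    using assms \<phi>(1) by blast
  finally show ?thesis .
qed

text \<open>
  The subspace is only real, so the real part of the functional is what can be controlled. The
  distance \<open>d\<close> from \<open>x\<close> to \<open>W\<close> is prescribed as a lower bound at \<open>x\<close>, and \<open>0\<close> on \<open>W\<close>; since
  \<open>W\<close> is symmetric, the latter means vanishing.
\<close>

lemma functional_separating_subspace:
  fixes W :: "'a::complex_normed_vector set"
  assumes W: "subspace W" and x: "x \<notin> closure W"
  obtains \<phi> where "\<And>w. w \<in> W \<Longrightarrow> Re (cdual_apply \<phi> w) = 0" "Re (cdual_apply \<phi> x) \<noteq> 0"
proof -
  obtain d where d: "0 < d" "\<And>w. w \<in> W \<Longrightarrow> d \<le> dist w x"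
    using x by (auto simp: closure_approachable not_less)
  define C where "C = (\<lambda>(t, w). (t *\<^sub>R x + w, t * d)) ` ({0..} \<times> W)"
  have "convex_cone C"
  proof -
    have "u + v \<in> C" if "u \<in> C" "v \<in> C" for u v
    proof -
      obtain s t w w' where "0 \<le> s" "0 \<le> t" "w \<in> W" "w' \<in> W"
          "u = (s *\<^sub>R x + w, s * d)" "v = (t *\<^sub>R x + w', t * d)"
        using \<open>u \<in> C\<close> \<open>v \<in> C\<close> by (auto simp: C_def)
      then show ?thesis
        unfolding C_def using subspace_add[OF W]
        by (intro image_eqI[of _ _ "(s + t, w + w')"]) (auto simp: algebra_simps)
    qed
    moreover have "c *\<^sub>R u \<in> C" if "u \<in> C" "0 \<le> c" for u c
    proof -
      obtain s w where "0 \<le> s" "w \<in> W" "u = (s *\<^sub>R x + w, s * d)"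
        using \<open>u \<in> C\<close> by (auto simp: C_def)
      then show ?thesis
        unfolding C_def using subspace_scale[OF W] \<open>0 \<le> c\<close>
        by (intro image_eqI[of _ _ "(c * s, c *\<^sub>R w)"]) (auto simp: algebra_simps)
    qed
    moreover have "0 \<in> C"
      unfolding C_def using subspace_0[OF W]
      by (intro image_eqI[of _ _ "(0, 0)"]) (auto simp: zero_prod_def)
    ultimately show ?thesis
      by (auto simp: convex_cone_iff)
  qed
  moreover have "r \<le> 1 * norm v" if "(v, r) \<in> C" for v r
  proof -
    obtain t w where tw: "0 \<le> t" "w \<in> W" "v = t *\<^sub>R x + w" "r = t * d"
      using \<open>(v, r) \<in> C\<close> by (auto simp: C_def)
    show ?thesis
    proof (cases "t = 0")
      case False
      \<comment> \<open>for t > 0, the point t x + w is t times the difference of x and a point of W\<close>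
      define w' where "w' = - (inverse t *\<^sub>R w)"
      have "w' \<in> W"
        unfolding w'_def using W tw(2) by (intro subspace_neg subspace_scale)
      then have "t * d \<le> t * norm (x - w')"
        using d(2)[of w'] tw(1) by (intro mult_left_mono) (simp_all add: dist_norm norm_minus_commute)
      also have "\<dots> = norm (t *\<^sub>R (x - w'))"
        using tw(1) by simp
      also have "t *\<^sub>R (x - w') = v"
        using False by (simp add: w'_def tw(3) algebra_simps)
      finally show ?thesis
        by (simp add: tw(4))
    qed (simp add: tw)
  qed
  ultimately obtain L where L: "linear L" "\<And>y. L y \<le> 1 * norm y" "\<And>w r. (w, r) \<in> C \<Longrightarrow> r \<le> L w"
    using mazur_orlicz[OF sublinear_norm[of 1]] by (metis zero_le_one)
  have "L w = 0" if "w \<in> W" for w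
  proof -
    have "0 \<le> L v" if "v \<in> W" for v
      using that by (intro L(3)) (auto simp: C_def intro!: image_eqI[of _ _ "(0, v)"])
    from this[of w] this[of "- w"] show ?thesis
      using that subspace_neg[OF W] linear_neg[OF L(1)] by auto
  qed
  moreover have "d \<le> L x"
    using subspace_0[OF W] by (intro L(3)) (auto simp: C_def intro!: image_eqI[of _ _ "(1, 0)"])
  moreover obtain \<phi> where "\<And>x. Re (cdual_apply \<phi> x) = L x"
    using cdual_with_real_part[OF L(1) _ L(2)] by (metis zero_le_one)
  ultimately show thesis
    using d(1) that[of \<phi>] by auto
qed

lemma norm_bidual_embedding: "norm (bidual_embedding x) = norm x"
proof (rule antisym)
  show "norm (bidual_embedding x) \<le> norm x"
    using norm_cdual_apply_le
    by (intro norm_cdual_le) (simp_all add: bidual_embedding_apply mult.commute)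
  show "norm x \<le> norm (bidual_embedding x)"
  proof (rule norm_le_if_functionals_le)
    fix \<phi> :: "'a cdual"
    assume "norm \<phi> \<le> 1"
    then show "cmod (cdual_apply \<phi> x) \<le> norm (bidual_embedding x)"
      using norm_cdual_apply_le[of "bidual_embedding x" \<phi>]
        mult_left_mono[of "norm \<phi>" 1 "norm (bidual_embedding x)"]
      by (simp add: bidual_embedding_apply)
  qed
qed

lemma bounded_linear_bidual_embedding: "bounded_linear bidual_embedding"
proof (rule bounded_linear_intro[where K = 1])
  show "bidual_embedding (x + y) = bidual_embedding x + bidual_embedding y" for x y :: 'a
    by (rule cdual_eqI)
      (simp add: bidual_embedding_apply cdual_apply_add linear_add[OF linear_cdual_apply])
  show "bidual_embedding (r *\<^sub>R x) = r *\<^sub>R bidual_embedding x" for r and x :: 'a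
    by (rule cdual_eqI)
      (simp add: bidual_embedding_apply cdual_apply_scaleR linear_cmul[OF linear_cdual_apply])
qed (simp add: norm_bidual_embedding)

lemmas linear_bidual_embedding = bounded_linear.linear[OF bounded_linear_bidual_embedding]

text \<open>
  The Banach-Alaoglu theorem, stated in the product topology on functions.
\<close>

lemma compact_dual_ball: "compact (cdual_apply ` cball (0 :: 'a::complex_normed_vector cdual) r)"
proof (cases "0 \<le> r")
  case False
  then show ?thesis
    by simp
next
  case True
  define K where "K = Pi UNIV (\<lambda>x :: 'a. cball (0 :: complex) (r * norm x))"
  define A :: "('a \<Rightarrow> complex) set" where "A = {f. \<forall>x y. f (x + y) = f x + f y}"
  define H :: "('a \<Rightarrow> complex) set" where "H = {f. \<forall>c x. f (c *\<^sub>C x) = c * f x}"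
  have "compactin (product_topology (\<lambda>x :: 'a. euclidean) UNIV) (PiE UNIV (\<lambda>x. cball (0 :: complex) (r * norm x)))"
    by (simp add: compactin_PiE)
  then have "compact K"
    by (simp add: K_def PiE_UNIV_domain euclidean_product_topology)
  moreover have "closed A"
    unfolding A_def
    by (intro closed_Collect_all closed_Collect_eq continuous_intros continuous_on_product_coordinates)
  moreover have "closed H"
    unfolding H_def
    by (intro closed_Collect_all closed_Collect_eq continuous_intros continuous_on_product_coordinates)
  ultimately have "compact (K \<inter> (A \<inter> H))"
    by (intro compact_Int_closed closed_Int)
  moreover have "cdual_apply ` cball (0 :: 'a cdual) r = K \<inter> (A \<inter> H)"
  proof (intro equalityI subsetI)
    fix f assume "f \<in> cdual_apply ` cball (0 :: 'a cdual) r"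
    then obtain \<phi> where \<phi>: "f = cdual_apply \<phi>" "norm \<phi> \<le> r"
      by auto
    have "cmod (f x) \<le> r * norm x" for x
      using norm_cdual_apply_le[of \<phi> x] mult_right_mono[OF \<phi>(2), of "norm x"] \<phi>(1) by simp
    then show "f \<in> K \<inter> (A \<inter> H)"
      by (auto simp: K_def A_def H_def \<phi>(1) cdual_apply_scaleC_right
          linear_add[OF linear_cdual_apply])
  next
    fix f assume "f \<in> K \<inter> (A \<inter> H)"
    then have "f (x + y) = f x + f y" "f (c *\<^sub>C x) = c * f x" "cmod (f x) \<le> r * norm x" for x y c
      by (simp_all add: K_def A_def H_def Pi_iff)
    then obtain \<phi> where "cdual_apply \<phi> = f" "norm \<phi> \<le> r"
      using cdual_of_functional[of f r] True by metis
    then show "f \<in> cdual_apply ` cball (0 :: 'a cdual) r"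
      by auto
  qed
  ultimately show ?thesis
    by simp
qed

section \<open>Helly's theorem\<close>

text \<open>
  Induction over \<open>A\<close>: if some functional vanishes on \<open>A\<close> but not at the new point \<open>a\<close>,
  subtracting a multiple of the evaluation at \<open>a\<close> makes \<open>\<eta>\<close> vanish on the annihilator of \<open>A\<close>
  alone.
\<close>

lemma evaluation_if_vanishes_on_annihilator:
  fixes \<eta> :: "'a::complex_normed_vector cdual cdual"
  assumes "finite A" and "\<And>\<phi>. (\<And>a. a \<in> A \<Longrightarrow> cdual_apply \<phi> a = 0) \<Longrightarrow> cdual_apply \<eta> \<phi> = 0"
  shows "\<eta> \<in> range bidual_embedding"
  using assms
proof (induction arbitrary: \<eta> rule: finite_induct)
  case empty
  then have "\<eta> = 0"
    by (intro cdual_eqI) (simp add: cdual_apply_zero)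
  then show ?case
    using linear_0[OF linear_bidual_embedding] by (metis rangeI)
next
  case (insert a A)
  show ?case
  proof (cases "\<exists>\<phi>. (\<forall>b\<in>A. cdual_apply \<phi> b = 0) \<and> cdual_apply \<phi> a \<noteq> 0")
    case False
    then show ?thesis
      using insert.prems by (intro insert.IH) blast
  next
    case True
    then obtain \<phi>0 where \<phi>0: "\<And>b. b \<in> A \<Longrightarrow> cdual_apply \<phi>0 b = 0" "cdual_apply \<phi>0 a \<noteq> 0"
      by blast
    define c where "c = cdual_apply \<eta> \<phi>0 / cdual_apply \<phi>0 a"
    have "\<eta> - bidual_embedding (c *\<^sub>C a) \<in> range bidual_embedding"
    proof (rule insert.IH)
      fix \<phi> assume \<phi>: "\<And>b. b \<in> A \<Longrightarrow> cdual_apply \<phi> b = 0"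
      define s where "s = cdual_apply \<phi> a / cdual_apply \<phi>0 a"
      have "cdual_apply \<eta> (\<phi> - s *\<^sub>C \<phi>0) = 0"
        using \<phi> \<phi>0 by (intro insert.prems) (auto simp: cdual_apply_minus cdual_apply_scaleC s_def)
      moreover have "cdual_apply \<eta> (\<phi> - s *\<^sub>C \<phi>0) = cdual_apply \<eta> \<phi> - s * cdual_apply \<eta> \<phi>0"
        by (simp add: cdual_apply_scaleC_right
            linear_diff[OF linear_cdual_apply])
      ultimately show "cdual_apply (\<eta> - bidual_embedding (c *\<^sub>C a)) \<phi> = 0"
        by (simp add: cdual_apply_minus bidual_embedding_apply cdual_apply_scaleC_right c_def s_def)
    qed
    then obtain x where "\<eta> - bidual_embedding (c *\<^sub>C a) = bidual_embedding x"
      by blast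
    then have "\<eta> = bidual_embedding (x + c *\<^sub>C a)"
      using linear_add[OF linear_bidual_embedding]
      by (metis diff_eq_eq)
    then show ?thesis
      by blast
  qed
qed

text \<open>
  The restriction of \<open>\<psi>\<close> to the annihilator of \<open>A\<close> has norm at most \<open>\<theta>\<close>, so it extends to some
  \<open>\<eta>\<close> of norm at most \<open>\<theta>\<close>. The difference \<open>\<psi> - \<eta>\<close> vanishes on the annihilator and hence is an
  evaluation.
\<close>

lemma helly_approximation:
  fixes \<psi> :: "'a::complex_normed_vector cdual cdual"
  assumes "finite A" and "0 \<le> \<theta>"
    and small: "\<And>\<phi>. norm \<phi> \<le> 1 \<Longrightarrow> (\<And>a. a \<in> A \<Longrightarrow> cdual_apply \<phi> a = 0) \<Longrightarrow> Re (cdual_apply \<psi> \<phi>) \<le> \<theta>"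
  obtains x where "norm (\<psi> - bidual_embedding x) \<le> \<theta>"
proof -
  define W where "W = {\<phi> :: 'a cdual. \<forall>a\<in>A. cdual_apply \<phi> a = 0}"
  define C where "C = (\<lambda>\<phi>. (\<phi>, Re (cdual_apply \<psi> \<phi>))) ` W"
  note lin = linear_cdual_apply
  have "convex_cone C"
    by (auto simp: convex_cone_iff C_def W_def image_iff zero_prod_def cdual_apply_zero
        cdual_apply_add cdual_apply_scaleR linear_0[OF lin] linear_add[OF lin] linear_cmul[OF lin])
  moreover have "r \<le> \<theta> * norm \<phi>" if "(\<phi>, r) \<in> C" for \<phi> r
  proof (cases "\<phi> = 0")
    case True
    then show ?thesis
      using that by (auto simp: C_def linear_0[OF lin])
  next
    case False
    have "\<phi> \<in> W" and r: "r = Re (cdual_apply \<psi> \<phi>)"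
      using that by (auto simp: C_def)
    then have "Re (cdual_apply \<psi> (inverse (norm \<phi>) *\<^sub>R \<phi>)) \<le> \<theta>"
      using False by (intro small) (auto simp: W_def cdual_apply_scaleR)
    then show ?thesis
      using False by (simp add: r linear_cmul[OF lin] field_simps)
  qed
  ultimately obtain L where L: "linear L" "\<And>y. L y \<le> \<theta> * norm y" "\<And>w r. (w, r) \<in> C \<Longrightarrow> r \<le> L w"
    using mazur_orlicz[OF sublinear_norm[OF \<open>0 \<le> \<theta>\<close>]] by metis
  obtain \<eta> where \<eta>: "\<And>\<phi>. Re (cdual_apply \<eta> \<phi>) = L \<phi>" "norm \<eta> \<le> \<theta>"
    using cdual_with_real_part[OF L(1) \<open>0 \<le> \<theta>\<close> L(2)] by metis
  have "\<psi> - \<eta> \<in> range bidual_embedding"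
  proof (rule evaluation_if_vanishes_on_annihilator[OF \<open>finite A\<close>])
    fix \<phi> assume "\<And>a. a \<in> A \<Longrightarrow> cdual_apply \<phi> a = 0"
    then have \<phi>: "\<phi> \<in> W"
      by (simp add: W_def)
    have Re0: "Re (cdual_apply (\<psi> - \<eta>) \<phi>') = 0" if "\<phi>' \<in> W" for \<phi>'
    proof -
      have le: "Re (cdual_apply \<psi> v) \<le> L v" if "v \<in> W" for v
        using that by (intro L(3)) (auto simp: C_def)
      have "- \<phi>' \<in> W"
        using that cdual_apply_minus[of 0 \<phi>'] by (auto simp: W_def cdual_apply_zero)
      then show ?thesis
        using le[OF that] le[of "- \<phi>'"]
        by (simp add: cdual_apply_minus \<eta>(1) linear_neg[OF lin] linear_neg[OF L(1)])
    qed
    \<comment> \<open>only real parts are controlled, so the imaginary part is read off at \<open>\<i> \<phi>\<close>\<close>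
    have "\<i> *\<^sub>C \<phi> \<in> W"
      using \<phi> by (auto simp: W_def cdual_apply_scaleC)
    then show "cdual_apply (\<psi> - \<eta>) \<phi> = 0"
      using Re0[OF \<phi>] Re0[of "\<i> *\<^sub>C \<phi>"] by (simp add: complex_eq_iff cdual_apply_scaleC_right)
  qed
  then obtain x where "\<psi> - \<eta> = bidual_embedding x"
    by blast
  then have "\<psi> - bidual_embedding x = \<eta>"
    by (metis diff_diff_eq2 diff_add_cancel add_diff_cancel_left')
  then show thesis
    using \<eta>(2) that by metis
qed

text \<open>
  Here completeness enters: the space is closed in its bidual, so \<open>\<psi>\<close> has a positive distance
  from it, and \<open>\<theta>\<close> can be any number below this distance.
\<close>

lemma helly_outside_space:
  fixes \<psi> :: "'a::complex_banach cdual cdual"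
  assumes "\<psi> \<notin> range bidual_embedding"
  obtains \<theta> where "0 < \<theta>" and "\<And>A. finite A \<Longrightarrow>
    \<exists>\<phi>. norm \<phi> \<le> 1 \<and> (\<forall>a\<in>A. cdual_apply \<phi> a = 0) \<and> \<theta> < Re (cdual_apply \<psi> \<phi>)"
proof -
  have "complete (range (bidual_embedding :: 'a \<Rightarrow> _))"
    by (rule complete_isometric_image[of 1])
      (auto simp: bounded_linear_bidual_embedding norm_bidual_embedding complete_UNIV)
  then have "\<psi> \<notin> closure (range bidual_embedding)"
    using assms by (simp add: closure_closed complete_imp_closed)
  then obtain e where e: "0 < e" "\<And>x. e \<le> norm (\<psi> - bidual_embedding x)"
    by (auto simp: closure_approachable dist_norm norm_minus_commute not_less)
  define \<theta> where "\<theta> = e / 2"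
  have \<theta>: "0 < \<theta>" "\<theta> < norm (\<psi> - bidual_embedding x)" for x
    using e(1) e(2)[of x] by (simp_all add: \<theta>_def)
  show thesis
  proof (rule that[OF \<theta>(1)], rule ccontr)
    fix A :: "'a set"
    assume "finite A"
      and "\<nexists>\<phi>. norm \<phi> \<le> 1 \<and> (\<forall>a\<in>A. cdual_apply \<phi> a = 0) \<and> \<theta> < Re (cdual_apply \<psi> \<phi>)"
    then obtain x where "norm (\<psi> - bidual_embedding x) \<le> \<theta>"
      using helly_approximation[of A \<theta> \<psi>] \<theta>(1) by (metis less_imp_le not_less)
    then show False
      using \<theta>(2)[of x] by simp
  qed
qed

section \<open>The weak topology as a topology of pointwise convergence\<close>

text \<open>
  The embedding into the bidual, with values in a function type, whose topology is the product
  topology.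
\<close>

definition evaluations :: "'a::complex_normed_vector \<Rightarrow> 'a cdual \<Rightarrow> complex"
  where "evaluations x = (\<lambda>\<phi>. cdual_apply \<phi> x)"

lemma evaluations_conv_bidual: "evaluations x = cdual_apply (bidual_embedding x)"
  by (simp add: evaluations_def bidual_embedding_apply fun_eq_iff)

lemma topspace_weak_topology [simp]: "topspace weak_topology = UNIV"
proof -
  have "cdual_apply \<phi> -` UNIV \<in> {cdual_apply \<phi> -` V | \<phi> V. open V}" for \<phi> :: "'a cdual"
    by blast
  then show ?thesis
    unfolding weak_topology_def topology_generated_by_topspace by auto
qed

lemma continuous_map_evaluations: "continuous_map weak_topology euclidean evaluations"
proof -
  have "continuous_map weak_topology euclidean (\<lambda>x. evaluations x \<phi>)" for \<phi> :: "'a cdual"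
  proof -
    have "openin weak_topology (cdual_apply \<phi> -` V)" if "open V" for V
      unfolding weak_topology_def using that by (intro topology_generated_by_Basis) blast
    moreover have "{x \<in> topspace weak_topology. evaluations x \<phi> \<in> V} = cdual_apply \<phi> -` V" for V
      by (auto simp: evaluations_def)
    ultimately show ?thesis
      by (simp add: continuous_map_def)
  qed
  then show ?thesis
    by (simp add: continuous_map_componentwise_UNIV flip: euclidean_product_topology)
qed

lemma openin_weak_topologyE:
  assumes "openin weak_topology W"
  obtains V where "open V" "W = evaluations -` V"
proof -
  have "generate_topology_on {cdual_apply \<phi> -` V | \<phi> V. open V} W"
    using assms by (simp add: weak_topology_def openin_topology_generated_by_iff)
  then have "\<exists>V. open V \<and> W = evaluations -` V"
  proof induction
    case Empty
    show ?case
      by (intro exI[of _ "{}"]) auto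
  next
    case (Int A B)
    then obtain V V' where "open V" "A = evaluations -` V" "open V'" "B = evaluations -` V'"
      by blast
    then show ?case
      by (intro exI[of _ "V \<inter> V'"]) auto
  next
    case (UN \<K>)
    then obtain V where "\<And>A. A \<in> \<K> \<Longrightarrow> open (V A) \<and> A = evaluations -` V A"
      by metis
    then show ?case
      by (intro exI[of _ "\<Union>(V ` \<K>)"]) blast
  next
    case (Basis A)
    then obtain \<phi> V where "open V" "A = cdual_apply \<phi> -` V"
      by blast
    moreover have "open ((\<lambda>g. g \<phi>) -` V)"
      using \<open>open V\<close> continuous_on_product_coordinates by (rule open_vimage)
    ultimately show ?case
      by (intro exI[of _ "(\<lambda>g. g \<phi>) -` V"]) (auto simp: evaluations_def)
  qed
  then show thesis
    using that by blast
qed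

lemma closed_if_compact_fun:
  fixes K :: "('a \<Rightarrow> 'b::metric_space) set"
  assumes "compact K"
  shows "closed K"
proof -
  have "Hausdorff_space (product_topology (\<lambda>_ :: 'a. euclidean :: 'b topology) UNIV)"
    by (simp add: Hausdorff_space_product_topology Hausdorff_space_euclidean)
  then have "Hausdorff_space (euclidean :: ('a \<Rightarrow> 'b) topology)"
    by (simp only: euclidean_product_topology)
  then show ?thesis
    using compactin_imp_closedin[of euclidean K] assms by simp
qed

text \<open>
  The weak topology is the one induced by \<open>evaluations\<close>, so the preimage of a compact set in
  the range is compact. That the whole of \<open>K\<close> is in the range is what makes its preimage
  compact.
\<close>

lemma relatively_weakly_compactI:
  assumes compact: "compact K" and sub: "K \<subseteq> range evaluations" and S: "evaluations ` S \<subseteq> K"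
  shows "relatively_weakly_compact S"
proof -
  have "compactin weak_topology (evaluations -` K)"
    unfolding compactin_def
  proof (intro conjI allI impI)
    fix \<U> assume \<U>: "Ball \<U> (openin weak_topology) \<and> evaluations -` K \<subseteq> \<Union>\<U>"
    define \<V> where "\<V> = {V. open V \<and> evaluations -` V \<in> \<U>}"
    have "K \<subseteq> \<Union>\<V>"
    proof
      fix g assume "g \<in> K"
      then obtain x where x: "g = evaluations x"
        using sub by blast
      then obtain W where "W \<in> \<U>" "x \<in> W"
        using \<U> \<open>g \<in> K\<close> by blast
      then obtain V where "open V" "W = evaluations -` V"
        using \<U> openin_weak_topologyE by metis
      then show "g \<in> \<Union>\<V>"
        using \<open>W \<in> \<U>\<close> \<open>x \<in> W\<close> x by (auto simp: \<V>_def)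
    qed
    then obtain \<F> where "\<F> \<subseteq> \<V>" "finite \<F>" "K \<subseteq> \<Union>\<F>"
      by (rule compactE[OF compact]) (auto simp: \<V>_def)
    then show "\<exists>\<F>. finite \<F> \<and> \<F> \<subseteq> \<U> \<and> evaluations -` K \<subseteq> \<Union>\<F>"
      unfolding \<V>_def by (intro exI[of _ "(\<lambda>V. evaluations -` V) ` \<F>"]) blast
  qed simp
  moreover have "closedin weak_topology (evaluations -` K)"
    using closedin_continuous_map_preimage[OF continuous_map_evaluations, of K]
      closed_if_compact_fun[OF compact] by (simp add: vimage_def)
  then have "weak_topology closure_of S \<subseteq> evaluations -` K"
    using S by (intro closure_of_minimal) auto
  ultimately show ?thesis
    unfolding relatively_weakly_compact_def by (rule closed_compactin) simp
qed

section \<open>The Cohen inequality in mean square form\<close>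

text \<open>
  Below the threshold \<open>\<kappa> powr (1 / q)\<close> the first summand suffices; above it \<open>t\<^sup>2\<close> is bounded
  below and \<open>t powr q\<close> is bounded above.
\<close>

lemma powr_le_add_square:
  fixes q \<kappa> :: real
  assumes "0 < q" and "0 < \<kappa>"
  obtains M where "0 < M" "\<And>t. \<lbrakk>0 \<le> t; t \<le> 2\<rbrakk> \<Longrightarrow> t powr q \<le> \<kappa> + M * t\<^sup>2"
proof -
  define a where "a = \<kappa> powr (1 / q)"
  have "0 < a"
    using assms by (simp add: a_def)
  have aq: "a powr q = \<kappa>"
    using assms by (simp add: a_def powr_powr)
  define M where "M = 2 powr q / a\<^sup>2"
  have "t powr q \<le> \<kappa> + M * t\<^sup>2" if "0 \<le> t" "t \<le> 2" for t
  proof (cases "t \<le> a")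
    case True
    then have "t powr q \<le> a powr q"
      using that assms by (intro powr_mono2) auto
    then show ?thesis
      using \<open>0 < a\<close> by (simp add: aq M_def add_increasing2)
  next
    case False
    have "t powr q \<le> 2 powr q * 1"
      using that assms by (simp add: powr_mono2)
    also have "\<dots> \<le> 2 powr q * (t\<^sup>2 / a\<^sup>2)"
      using False \<open>0 < a\<close> by (intro mult_left_mono) (simp_all add: power_mono)
    finally show ?thesis
      using assms by (simp add: M_def)
  qed
  then show thesis
    using \<open>0 < a\<close> that[of M] by (simp add: M_def)
qed

lemma conjugate_exponent_pos:
  assumes "1 < p"
  shows "0 < conjugate_exponent p"
  using assms by (cases p) (auto simp: conjugate_exponent_def)

lemma lp_norm_conjugate_weights_le_1:
  assumes p: "1 < p" and "1 \<le> n" and w: "\<And>i. i \<in> {1..n} \<Longrightarrow> 0 \<le> w i" "(\<Sum>i=1..n. w i) = 1"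
  shows "lp_norm p n (\<lambda>i. of_real (w i powr (1 - 1 / conjugate_exponent p))) \<le> 1"
proof (cases "p = \<infinity>")
  case True
  have "Max ((\<lambda>i. cmod (of_real (w i powr 0))) ` {1..n}) \<le> 1"
  proof (rule Max.boundedI)
    show "(\<lambda>i. cmod (of_real (w i powr 0))) ` {1..n} \<noteq> {}"
      using \<open>1 \<le> n\<close> by (simp only: image_is_empty) simp
  qed auto
  then show ?thesis
    using True by (simp add: lp_norm_def conjugate_exponent_def)
next
  case False
  define r where "r = real_of_ereal p"
  have r: "1 < r"
    using p False by (cases p) (auto simp: r_def)
  have "1 - 1 / conjugate_exponent p = 1 / r"
    using r False by (simp add: conjugate_exponent_def r_def[symmetric] field_simps)
  then have "lp_norm p n (\<lambda>i. of_real (w i powr (1 - 1 / conjugate_exponent p))) =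
      (\<Sum>i=1..n. (w i powr (1 / r)) powr r) powr (1 / r)"
    using False by (simp add: lp_norm_def r_def[symmetric])
  also have "(\<Sum>i=1..n. (w i powr (1 / r)) powr r) = (\<Sum>i=1..n. w i)"
    using r w(1) by (intro sum.cong) (auto simp: powr_powr)
  finally show ?thesis
    unfolding w(2) by simp
qed

lemma weak_lp_norm_weighted_le:
  fixes z :: "nat \<Rightarrow> 'a::complex_normed_vector cdual"
  assumes q: "0 < q" and w: "\<And>i. i \<in> {1..n} \<Longrightarrow> 0 \<le> w i"
    and le: "\<And>\<eta>. norm \<eta> \<le> 1 \<Longrightarrow> (\<Sum>i=1..n. w i * cmod (cdual_apply \<eta> (z i)) powr q) \<le> \<kappa>"
  shows "weak_lp_norm q n (\<lambda>i. (w i powr (1 / q)) *\<^sub>R z i) \<le> \<kappa> powr (1 / q)"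
  unfolding weak_lp_norm_def
proof (rule cSUP_least)
  fix \<eta> :: "'a cdual cdual" assume "\<eta> \<in> cball 0 1"
  have "cmod (cdual_apply \<eta> ((w i powr (1 / q)) *\<^sub>R z i)) powr q = w i * cmod (cdual_apply \<eta> (z i)) powr q"
    if "i \<in> {1..n}" for i
    using w[OF that] q
    by (simp add: linear_cmul[OF linear_cdual_apply]
        norm_mult powr_mult powr_powr)
  then have "(\<Sum>i=1..n. cmod (cdual_apply \<eta> ((w i powr (1 / q)) *\<^sub>R z i)) powr q) \<le> \<kappa>"
    using le \<open>\<eta> \<in> cball 0 1\<close> by simp
  then show "(\<Sum>i=1..n. cmod (cdual_apply \<eta> ((w i powr (1 / q)) *\<^sub>R z i)) powr q) powr (1 / q) \<le> \<kappa> powr (1 / q)"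
    using q by (intro powr_mono2 sum_nonneg) auto
qed simp

text \<open>
  Splitting the weight \<open>w\<^sub>i\<close> as \<open>w\<^sub>i powr (1 - 1/q) * w\<^sub>i powr (1/q)\<close>, the first factor goes
  into the scalars, whose norm then is at most \<open>1\<close>, and the second one into the functionals.
  The index set is arbitrary so that it can follow the structure of a particular family.
\<close>

lemma cohen_weighted_inequality:
  fixes f :: "'e::complex_normed_vector \<Rightarrow> 'f::complex_normed_vector"
  assumes "1 < p" and "cohen_strongly_summing p f U"
  shows "\<exists>C\<ge>0. \<forall>(I :: 'i set) w z t \<kappa>.
    finite I \<and> sum w I = 1 \<and> (\<forall>i\<in>I. 0 \<le> w i \<and> t i \<in> U) \<and>
    (\<forall>\<eta>. norm \<eta> \<le> 1 \<longrightarrow> (\<Sum>i\<in>I. w i * cmod (cdual_apply \<eta> (z i)) powr conjugate_exponent p) \<le> \<kappa>)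
    \<longrightarrow> (\<Sum>i\<in>I. w i * cmod (cdual_apply (z i) (f (t i)))) \<le> C * \<kappa> powr (1 / conjugate_exponent p)"
proof -
  define q where "q = conjugate_exponent p"
  have q: "0 < q"
    using conjugate_exponent_pos[OF \<open>1 < p\<close>] by (simp add: q_def)
  obtain C where "0 \<le> C" and C: "\<And>n \<alpha> x (y :: nat \<Rightarrow> 'f cdual). \<lbrakk>1 \<le> n; \<And>i. i \<in> {1..n} \<Longrightarrow> x i \<in> U\<rbrakk> \<Longrightarrow>
      (\<Sum>i=1..n. cmod (\<alpha> i) * cmod (cdual_apply (y i) (f (x i)))) \<le> C * lp_norm p n \<alpha> * weak_lp_norm q n y"
    using assms(2) unfolding cohen_strongly_summing_def q_def by metis
  show ?thesis
  proof (intro exI[of _ C] conjI allI impI)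
    show "0 \<le> C"
      by fact
    fix I :: "'i set" and w :: "'i \<Rightarrow> real" and z :: "'i \<Rightarrow> 'f cdual" and t and \<kappa> :: real
    assume A: "finite I \<and> sum w I = 1 \<and> (\<forall>i\<in>I. 0 \<le> w i \<and> t i \<in> U) \<and>
      (\<forall>\<eta>. norm \<eta> \<le> 1 \<longrightarrow> (\<Sum>i\<in>I. w i * cmod (cdual_apply \<eta> (z i)) powr conjugate_exponent p) \<le> \<kappa>)"
    then have "finite I" and sum1: "sum w I = 1"
      and w: "\<And>i. i \<in> I \<Longrightarrow> 0 \<le> w i" and t: "\<And>i. i \<in> I \<Longrightarrow> t i \<in> U"
      and le: "\<And>\<eta>. norm \<eta> \<le> 1 \<Longrightarrow>
        (\<Sum>i\<in>I. w i * cmod (cdual_apply \<eta> (z i)) powr conjugate_exponent p) \<le> \<kappa>"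
      by blast+
    obtain h where h: "bij_betw h {1..card I} I"
      using ex_bij_betw_nat_finite_1[OF \<open>finite I\<close>] by blast
    define n where "n = card I"
    have hI: "h i \<in> I" if "i \<in> {1..n}" for i
      using h that by (auto simp: bij_betw_def n_def)
    have transfer: "(\<Sum>i=1..n. g (h i)) = sum g I" for g :: "'i \<Rightarrow> real"
      using sum.reindex_bij_betw[OF h] by (simp add: n_def)
    have "1 \<le> n"
      using sum1 by (cases n) (use transfer[of w] in auto)
    define \<alpha> where "\<alpha> i = complex_of_real (w (h i) powr (1 - 1 / q))" for i
    define y where "y i = (w (h i) powr (1 / q)) *\<^sub>R z (h i)" for i
    have "lp_norm p n \<alpha> \<le> 1"
      unfolding \<alpha>_def q_def using assms(1) \<open>1 \<le> n\<close> w hI transfer[of w] sum1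
      by (intro lp_norm_conjugate_weights_le_1) auto
    moreover have "weak_lp_norm q n y \<le> \<kappa> powr (1 / q)"
      unfolding y_def
    proof (rule weak_lp_norm_weighted_le[OF q])
      show "0 \<le> w (h i)" if "i \<in> {1..n}" for i
        using w hI that by blast
      show "(\<Sum>i=1..n. w (h i) * cmod (cdual_apply \<eta> (z (h i))) powr q) \<le> \<kappa>" if "norm \<eta> \<le> 1" for \<eta>
        using le[OF that] transfer[of "\<lambda>i. w i * cmod (cdual_apply \<eta> (z i)) powr q"] by (simp add: q_def)
    qed
    moreover have "0 \<le> weak_lp_norm q n y"
      unfolding weak_lp_norm_def
      by (rule cSUP_upper2[OF bdd_above_weak_lp_norm[OF q], of 0]) simp_all
    ultimately have "lp_norm p n \<alpha> * weak_lp_norm q n y \<le> \<kappa> powr (1 / q)"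
      using mult_right_mono[of "lp_norm p n \<alpha>" 1 "weak_lp_norm q n y"] by simp
    then have "C * lp_norm p n \<alpha> * weak_lp_norm q n y \<le> C * \<kappa> powr (1 / q)"
      using \<open>0 \<le> C\<close> by (simp add: mult_left_mono mult.assoc)
    moreover have "cmod (\<alpha> i) * cmod (cdual_apply (y i) (f (t (h i)))) =
        w (h i) * cmod (cdual_apply (z (h i)) (f (t (h i))))" if "i \<in> {1..n}" for i
      using w[OF hI[OF that]]
      by (simp add: \<alpha>_def y_def cdual_apply_scaleR norm_mult mult.assoc[symmetric] powr_add[symmetric])
    ultimately show "(\<Sum>i\<in>I. w i * cmod (cdual_apply (z i) (f (t i)))) \<le> C * \<kappa> powr (1 / conjugate_exponent p)"
      using C[of n "\<lambda>i. t (h i)" \<alpha> y] \<open>1 \<le> n\<close> t hI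
        transfer[of "\<lambda>i. w i * cmod (cdual_apply (z i) (f (t i)))"]
      by (simp add: q_def)
  qed
qed

text \<open>
  The only consequence of the Cohen inequality, apart from boundedness, that the compactness
  arguments use. The exponent has disappeared.
\<close>

lemma cohen_mean_square_lower_bound:
  fixes f :: "'e::complex_normed_vector \<Rightarrow> 'f::complex_normed_vector"
  assumes "1 < p" and "cohen_strongly_summing p f U" and "0 < \<delta>"
  shows "\<exists>\<epsilon>>0. \<forall>(I :: 'i set) w z t. finite I \<and> sum w I = 1 \<and>
    (\<forall>i\<in>I. 0 \<le> w i \<and> t i \<in> U \<and> norm (z i) \<le> 2 \<and> \<delta> \<le> cmod (cdual_apply (z i) (f (t i))))
    \<longrightarrow> (\<exists>\<eta>. norm \<eta> \<le> 1 \<and> \<epsilon> < (\<Sum>i\<in>I. w i * (cmod (cdual_apply \<eta> (z i)))\<^sup>2))"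
proof -
  define q where "q = conjugate_exponent p"
  have q: "0 < q"
    using conjugate_exponent_pos[OF \<open>1 < p\<close>] by (simp add: q_def)
  obtain C where "0 \<le> C" and C: "\<And>(I :: 'i set) w z t \<kappa>.
    finite I \<and> sum w I = 1 \<and> (\<forall>i\<in>I. 0 \<le> w i \<and> t i \<in> U) \<and>
    (\<forall>\<eta>. norm \<eta> \<le> 1 \<longrightarrow> (\<Sum>i\<in>I. w i * cmod (cdual_apply \<eta> (z i)) powr q) \<le> \<kappa>)
    \<Longrightarrow> (\<Sum>i\<in>I. w i * cmod (cdual_apply (z i) (f (t i)))) \<le> C * \<kappa> powr (1 / q)"
    using cohen_weighted_inequality[OF assms(1,2), where 'i = 'i] unfolding q_def by blast
  \<comment> \<open>chosen such that the q-mean bound \<open>\<kappa>\<close> would give a mean of values below \<open>\<delta>\<close>\<close>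
  define \<kappa> where "\<kappa> = (\<delta> / (C + 1)) powr q"
  have "0 < \<kappa>"
    using \<open>0 < \<delta>\<close> \<open>0 \<le> C\<close> by (simp add: \<kappa>_def)
  have "C * \<kappa> powr (1 / q) = C * (\<delta> / (C + 1))"
    using q \<open>0 < \<delta>\<close> \<open>0 \<le> C\<close> by (simp add: \<kappa>_def powr_powr)
  also have "\<dots> < \<delta>"
    using \<open>0 < \<delta>\<close> \<open>0 \<le> C\<close> by (simp add: field_simps)
  finally have less: "C * \<kappa> powr (1 / q) < \<delta>" .
  obtain M where "0 < M" and M: "\<And>t. \<lbrakk>0 \<le> t; t \<le> 2\<rbrakk> \<Longrightarrow> t powr q \<le> \<kappa> / 2 + M * t\<^sup>2"
    using powr_le_add_square[OF q, of "\<kappa> / 2"] \<open>0 < \<kappa>\<close> by (metis half_gt_zero)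
  \<comment> \<open>one half of \<open>\<kappa>\<close> pays for the constant term, the other half for the squares\<close>
  define \<epsilon> where "\<epsilon> = \<kappa> / (2 * M)"
  show ?thesis
  proof (intro exI[of _ \<epsilon>] conjI allI impI)
    show "0 < \<epsilon>"
      using \<open>0 < \<kappa>\<close> \<open>0 < M\<close> by (simp add: \<epsilon>_def)
    fix I :: "'i set" and w :: "'i \<Rightarrow> real" and z :: "'i \<Rightarrow> 'f cdual" and t
    assume A: "finite I \<and> sum w I = 1 \<and>
      (\<forall>i\<in>I. 0 \<le> w i \<and> t i \<in> U \<and> norm (z i) \<le> 2 \<and> \<delta> \<le> cmod (cdual_apply (z i) (f (t i))))"
    then have I: "finite I" "sum w I = 1" "\<And>i. i \<in> I \<Longrightarrow> 0 \<le> w i" "\<And>i. i \<in> I \<Longrightarrow> t i \<in> U"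
      and z: "\<And>i. i \<in> I \<Longrightarrow> norm (z i) \<le> 2"
      and big: "\<And>i. i \<in> I \<Longrightarrow> \<delta> \<le> cmod (cdual_apply (z i) (f (t i)))"
      by blast+
    show "\<exists>\<eta>. norm \<eta> \<le> 1 \<and> \<epsilon> < (\<Sum>i\<in>I. w i * (cmod (cdual_apply \<eta> (z i)))\<^sup>2)"
    proof (rule ccontr)
      assume "\<not> ?thesis"
      then have small: "(\<Sum>i\<in>I. w i * (cmod (cdual_apply \<eta> (z i)))\<^sup>2) \<le> \<epsilon>" if "norm \<eta> \<le> 1" for \<eta>
        using that by (metis not_less)
      have "(\<Sum>i\<in>I. w i * cmod (cdual_apply \<eta> (z i)) powr q) \<le> \<kappa>" if \<eta>: "norm \<eta> \<le> 1" for \<eta>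
      proof -
        have "(\<Sum>i\<in>I. w i * cmod (cdual_apply \<eta> (z i)) powr q)
            \<le> (\<Sum>i\<in>I. w i * (\<kappa> / 2 + M * (cmod (cdual_apply \<eta> (z i)))\<^sup>2))"
          using norm_cdual_apply_le_of_norm_le_1[OF \<eta>] z order_trans
          by (intro sum_mono mult_left_mono I M) (auto intro: order_trans)
        also have "\<dots> = \<kappa> / 2 * sum w I + M * (\<Sum>i\<in>I. w i * (cmod (cdual_apply \<eta> (z i)))\<^sup>2)"
          by (simp add: algebra_simps sum.distrib sum_distrib_left sum_divide_distrib)
        also have "\<dots> \<le> \<kappa> / 2 + M * \<epsilon>"
          using small[OF \<eta>] \<open>0 < M\<close> I(2) by simp
        also have "\<dots> = \<kappa>"
          using \<open>0 < M\<close> by (simp add: \<epsilon>_def)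
        finally show ?thesis .
      qed
      then have "(\<Sum>i\<in>I. w i * cmod (cdual_apply (z i) (f (t i)))) < \<delta>"
        using C[of I w t z \<kappa>] I less by (auto intro: le_less_trans)
      moreover have "(\<Sum>i\<in>I. w i * \<delta>) \<le> (\<Sum>i\<in>I. w i * cmod (cdual_apply (z i) (f (t i))))"
        using big I(3) by (intro sum_mono mult_left_mono) auto
      ultimately show False
        using I(2) by (simp flip: sum_distrib_right)
    qed
  qed
qed

lemma cohen_range_bounded:
  fixes f :: "'e::complex_normed_vector \<Rightarrow> 'f::complex_normed_vector"
  assumes "1 < p" and "cohen_strongly_summing p f U"
  obtains r where "\<And>x. x \<in> U \<Longrightarrow> norm (f x) \<le> r"
proof -
  obtain C where C: "\<And>(I :: unit set) w z t \<kappa>.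
    finite I \<and> sum w I = 1 \<and> (\<forall>i\<in>I. 0 \<le> w i \<and> t i \<in> U) \<and>
    (\<forall>\<eta>. norm \<eta> \<le> 1 \<longrightarrow> (\<Sum>i\<in>I. w i * cmod (cdual_apply \<eta> (z i)) powr conjugate_exponent p) \<le> \<kappa>)
    \<Longrightarrow> (\<Sum>i\<in>I. w i * cmod (cdual_apply (z i) (f (t i)))) \<le> C * \<kappa> powr (1 / conjugate_exponent p)"
    using cohen_weighted_inequality[OF assms, where 'i = unit] by blast
  have "norm (f x) \<le> C" if "x \<in> U" for x
  proof (rule norm_le_if_functionals_le)
    fix \<phi> :: "'f cdual" assume \<phi>: "norm \<phi> \<le> 1"
    have "cmod (cdual_apply \<eta> \<phi>) powr conjugate_exponent p \<le> 1" if "norm \<eta> \<le> 1" for \<eta>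
    proof -
      have "cmod (cdual_apply \<eta> \<phi>) \<le> 1"
        using norm_cdual_apply_le_of_norm_le_1[OF that] \<phi> order_trans by blast
      then show ?thesis
        using conjugate_exponent_pos[OF assms(1)] by (intro powr_le1) auto
    qed
    then show "cmod (cdual_apply \<phi> (f x)) \<le> C"
      using C[of UNIV "\<lambda>_. 1" "\<lambda>_. x" "\<lambda>_. \<phi>" 1] that by simp
  qed
  then show thesis
    using that by blast
qed

section \<open>Dyadic differences\<close>

text \<open>
  \<open>dyadic_mean y k m\<close> is the mean of \<open>y\<close> over the interval \<open>{m * 2\<^sup>k ..< (m + 1) * 2\<^sup>k}\<close>.
\<close>

primrec dyadic_mean :: "(nat \<Rightarrow> 'a::real_vector) \<Rightarrow> nat \<Rightarrow> nat \<Rightarrow> 'a" where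
  "dyadic_mean y 0 m = y m"
| "dyadic_mean y (Suc k) m = (1/2) *\<^sub>R (dyadic_mean y k (2 * m) + dyadic_mean y k (2 * m + 1))"

definition dyadic_gap :: "(nat \<Rightarrow> 'a::real_vector) \<Rightarrow> nat \<Rightarrow> nat \<Rightarrow> 'a"
  where "dyadic_gap y k m = dyadic_mean y k (2 * m) - dyadic_mean y k (2 * m + 1)"

lemma dyadic_mean_linear:
  assumes "linear T"
  shows "T (dyadic_mean y k m) = dyadic_mean (\<lambda>j. T (y j)) k m"
  by (induction k arbitrary: m) (simp_all add: linear_cmul[OF assms] linear_add[OF assms])

lemma dyadic_mean_in_convex:
  assumes "convex S" and "\<And>j. \<lbrakk>m * 2 ^ k \<le> j; j < Suc m * 2 ^ k\<rbrakk> \<Longrightarrow> y j \<in> S"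
  shows "dyadic_mean y k m \<in> S"
  using assms(2)
proof (induction k arbitrary: m)
  case 0
  then show ?case
    by simp
next
  case (Suc k)
  have "dyadic_mean y k (2 * m) \<in> S" "dyadic_mean y k (2 * m + 1) \<in> S"
    by (rule Suc.IH, rule Suc.prems; simp add: algebra_simps)+
  then have "(1/2) *\<^sub>R dyadic_mean y k (2 * m) + (1/2) *\<^sub>R dyadic_mean y k (2 * m + 1) \<in> S"
    using \<open>convex S\<close> by (intro convexD) auto
  then show ?case
    by (simp add: scaleR_add_right)
qed

lemma sum_even_odd: "(\<Sum>i<2 * n. f i) = (\<Sum>i<n. f (2 * i) + f (2 * i + 1))"
  for f :: "nat \<Rightarrow> 'a::comm_monoid_add"
  by (induction n) (simp_all add: add.assoc)

text \<open>
  The dyadic means form a martingale. By the parallelogram law the mean square of the gaps at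
  level \<open>k\<close> is four times the drop of the mean square \<open>e\<close> of the dyadic means from level \<open>k\<close>
  to level \<open>k + 1\<close>, so the sum over the levels telescopes.
\<close>

lemma dyadic_gap_mean_square:
  fixes b :: "nat \<Rightarrow> complex"
  assumes "\<And>j. cmod (b j) \<le> 1"
  shows "(\<Sum>k<K. (\<Sum>m<2 ^ (K - Suc k). (cmod (dyadic_gap b k m))\<^sup>2) / 2 ^ (K - Suc k)) \<le> 4"
proof -
  \<comment> \<open>the mean square of the dyadic means of level k, a mean over 2 ^ (K - k) intervals\<close>
  define e where "e k = (\<Sum>m<2 ^ (K - k). (cmod (dyadic_mean b k m))\<^sup>2) / 2 ^ (K - k)" for k
  have "(\<Sum>m<2 ^ (K - Suc k). (cmod (dyadic_gap b k m))\<^sup>2) / 2 ^ (K - Suc k) = 4 * (e k - e (Suc k))"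
    if "k < K" for k
  proof -
    define n :: nat where "n = 2 ^ (K - Suc k)"
    have n: "2 ^ (K - k) = 2 * n" "0 < n"
      using \<open>k < K\<close> by (simp_all add: n_def Suc_diff_Suc flip: power_Suc)
    have parallelogram: "(cmod (dyadic_gap b k m))\<^sup>2 = 2 * ((cmod (dyadic_mean b k (2 * m)))\<^sup>2
        + (cmod (dyadic_mean b k (2 * m + 1)))\<^sup>2) - 4 * (cmod (dyadic_mean b (Suc k) m))\<^sup>2" for m
    proof -
      have *: "(cmod (u - v))\<^sup>2 = 2 * ((cmod u)\<^sup>2 + (cmod v)\<^sup>2) - (cmod (u + v))\<^sup>2" for u v
        by (simp only: cmod_power2) (simp add: power2_eq_square algebra_simps)
      show ?thesis
        unfolding dyadic_gap_def * by (simp add: power2_eq_square)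
    qed
    have "(\<Sum>m<n. (cmod (dyadic_gap b k m))\<^sup>2) =
        2 * (\<Sum>m<2 * n. (cmod (dyadic_mean b k m))\<^sup>2) - 4 * (\<Sum>m<n. (cmod (dyadic_mean b (Suc k) m))\<^sup>2)"
      unfolding parallelogram sum_even_odd by (simp add: sum_subtractf sum_distrib_left)
    moreover have "e k = (\<Sum>m<2 * n. (cmod (dyadic_mean b k m))\<^sup>2) / real (2 * n)"
      unfolding e_def n(1)[symmetric] by simp
    moreover have "e (Suc k) = (\<Sum>m<n. (cmod (dyadic_mean b (Suc k) m))\<^sup>2) / real n"
      unfolding e_def n_def by simp
    ultimately show ?thesis
      using n(2) unfolding n_def[symmetric]
      by (simp add: n_def[symmetric] field_simps flip: n_def of_nat_power)
        (simp add: n_def field_simps)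
  qed
  then have "(\<Sum>k<K. (\<Sum>m<2 ^ (K - Suc k). (cmod (dyadic_gap b k m))\<^sup>2) / 2 ^ (K - Suc k)) =
      (\<Sum>k<K. 4 * (e k - e (Suc k)))"
    by (intro sum.cong) auto
  also have "\<dots> = 4 * (e 0 - e K)"
    unfolding sum_distrib_left[symmetric] sum_lessThan_telescope' ..
  also have "\<dots> \<le> 4 * e 0"
    by (simp add: e_def sum_nonneg)
  also have "e 0 \<le> 1"
  proof -
    have "(\<Sum>m<2 ^ K. (cmod (b m))\<^sup>2) \<le> (\<Sum>m<(2::nat) ^ K. 1 :: real)"
      using assms by (intro sum_mono) (simp add: power_le_one)
    then show ?thesis
      by (simp add: e_def)
  qed
  finally show ?thesis
    by simp
qed

lemma dyadic_gap_weighted_mean_square: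
  fixes b :: "nat \<Rightarrow> complex"
  assumes "\<And>j. cmod (b j) \<le> 1" and "0 < K"
  shows "(\<Sum>(k, m)\<in>(SIGMA k:{..<K}. {..<2 ^ (K - Suc k)}).
      1 / (real K * 2 ^ (K - Suc k)) * (cmod (dyadic_gap b k m))\<^sup>2) \<le> 4 / real K"
proof -
  have "(\<Sum>(k, m)\<in>(SIGMA k:{..<K}. {..<2 ^ (K - Suc k)}).
      1 / (real K * 2 ^ (K - Suc k)) * (cmod (dyadic_gap b k m))\<^sup>2)
    = (\<Sum>k<K. (\<Sum>m<2 ^ (K - Suc k). (cmod (dyadic_gap b k m))\<^sup>2) / 2 ^ (K - Suc k)) / real K"
    by (simp add: sum.Sigma[symmetric] sum_divide_distrib mult.commute)
  also have "\<dots> \<le> 4 / real K"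
    using dyadic_gap_mean_square[of b K] assms by (intro divide_right_mono) auto
  finally show ?thesis .
qed

section \<open>Relative weak compactness of the range\<close>

text \<open>
  If every finite subset can be prolonged by a point in relation \<open>R\<close> to all its members, then
  there is a sequence each of whose terms is related to all later ones. This one scheme
  produces triangular arrays and separated sequences.
\<close>

lemma greedy_sequence:
  assumes "\<And>Y. finite Y \<Longrightarrow> Y \<subseteq> X \<Longrightarrow> \<exists>x\<in>X. \<forall>y\<in>Y. R y x"
  shows "\<exists>f :: nat \<Rightarrow> 'a. (\<forall>n. f n \<in> X) \<and> (\<forall>m n. m < n \<longrightarrow> R (f m) (f n))"
proof -
  define P where "P f n x \<longleftrightarrow> x \<in> X \<and> (\<forall>m<n. R (f m) x)" for f :: "nat \<Rightarrow> 'a" and n x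
  have "\<exists>f. \<forall>n. P f n (f n)"
  proof (rule dependent_wellorder_choice)
    show "P f n x = P g n x" if "\<And>m. m < n \<Longrightarrow> f m = g m" for x f g n
      using that by (simp add: P_def)
    show "\<exists>x. P f n x" if "\<And>m. m < n \<Longrightarrow> P f m (f m)" for n f
    proof -
      have "f ` {..<n} \<subseteq> X"
        using that by (auto simp: P_def)
      then obtain x where "x \<in> X" "\<forall>y\<in>f ` {..<n}. R y x"
        using assms[of "f ` {..<n}"] by blast
      then show ?thesis
        by (auto simp: P_def)
    qed
  qed
  then show ?thesis
    by (auto simp: P_def)
qed

text \<open>
  The gap over the two halves \<open>2 * m\<close> and \<open>2 * m + 1\<close> is tested at \<open>s n\<close> where \<open>n\<close> is the last
  index of the left half: all functionals of the left half are large there and all those of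
  the right half vanish. By the martingale estimate the mean square of the gaps is at most
  \<open>4 / K\<close>.
\<close>

lemma cohen_no_triangular_array:
  fixes f :: "'e::complex_normed_vector \<Rightarrow> 'f::complex_normed_vector"
  assumes "1 < p" and "cohen_strongly_summing p f U" and "0 < \<theta>"
    and y: "\<And>j :: nat. norm (y j) \<le> 1" and s: "\<And>n. s n \<in> U"
    and on: "\<And>j n. j \<le> n \<Longrightarrow> \<theta> \<le> Re (cdual_apply (y j) (f (s n)))"
    and off: "\<And>j n. n < j \<Longrightarrow> cdual_apply (y j) (f (s n)) = 0"
  shows False
proof -
  obtain \<epsilon> where "0 < \<epsilon>" and \<epsilon>: "\<And>(I :: (nat \<times> nat) set) w z t. finite I \<and> sum w I = 1 \<and>
    (\<forall>i\<in>I. 0 \<le> w i \<and> t i \<in> U \<and> norm (z i) \<le> 2 \<and> \<theta> \<le> cmod (cdual_apply (z i) (f (t i))))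
    \<Longrightarrow> (\<exists>\<eta>. norm \<eta> \<le> 1 \<and> \<epsilon> < (\<Sum>i\<in>I. w i * (cmod (cdual_apply \<eta> (z i)))\<^sup>2))"
    using cohen_mean_square_lower_bound[OF assms(1-3), where 'i = "nat \<times> nat"] by blast
  obtain K :: nat where K: "4 / \<epsilon> < real K"
    using reals_Archimedean2 by blast
  then have "0 < K"
    using \<open>0 < \<epsilon>\<close> by (cases K) (auto simp: not_less)
  define I where "I = (SIGMA k:{..<K}. {..<(2::nat) ^ (K - Suc k)})"
  \<comment> \<open>equal weight for the K levels, and equal weight for the intervals of a level\<close>
  define w where "w = (\<lambda>(k, m :: nat). 1 / (real K * 2 ^ (K - Suc k)))"
  define z where "z = (\<lambda>(k, m). dyadic_gap y k m)"
  define t where "t = (\<lambda>(k, m). s (Suc (2 * m) * 2 ^ k - 1))"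
  have "finite I"
    by (simp add: I_def)
  moreover have "sum w I = 1"
    using \<open>0 < K\<close> by (simp add: I_def w_def sum.Sigma[symmetric])
  moreover have "0 \<le> w i \<and> t i \<in> U \<and> norm (z i) \<le> 2 \<and> \<theta> \<le> cmod (cdual_apply (z i) (f (t i)))"
    if "i \<in> I" for i
  proof -
    obtain k m where i: "i = (k, m)"
      by fastforce
    define x where "x = f (t i)"
    have "norm (dyadic_mean y k n) \<le> 1" for n
      using dyadic_mean_in_convex[of "cball 0 1" n k y] y by simp
    then have "norm (z i) \<le> 2"
      using norm_triangle_ineq4[of "dyadic_mean y k (2 * m)" "dyadic_mean y k (2 * m + 1)"]
      by (simp add: i z_def dyadic_gap_def) (smt (verit))
    moreover have "\<theta> \<le> cmod (cdual_apply (z i) x)"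
    proof -
      have lin: "linear (\<lambda>\<phi>. cdual_apply \<phi> x)"
        by (rule bounded_linear.linear[OF bounded_linear_cdual_apply_left])
      have "dyadic_mean (\<lambda>j. cdual_apply (y j) x) k (2 * m) \<in> {c. \<theta> \<le> Re c}"
        using on by (intro dyadic_mean_in_convex convex_halfspace_Re_ge) (auto simp: x_def i t_def)
      moreover have "dyadic_mean (\<lambda>j. cdual_apply (y j) x) k (2 * m + 1) \<in> {0}"
        using off by (intro dyadic_mean_in_convex) (auto simp: x_def i t_def)
      ultimately have "\<theta> \<le> Re (cdual_apply (z i) x)"
        by (simp add: i z_def dyadic_gap_def cdual_apply_minus dyadic_mean_linear[OF lin])
      then show ?thesis
        using complex_Re_le_cmod order_trans by blast
    qed
    ultimately show ?thesis
      using s by (simp add: w_def t_def x_def i)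
  qed
  ultimately obtain \<eta> where \<eta>: "norm \<eta> \<le> 1"
      and "\<epsilon> < (\<Sum>i\<in>I. w i * (cmod (cdual_apply \<eta> (z i)))\<^sup>2)"
    using \<epsilon>[of I w t z] by blast
  note this(2)
  also have "(\<Sum>i\<in>I. w i * (cmod (cdual_apply \<eta> (z i)))\<^sup>2)
      = (\<Sum>(k, m)\<in>I. 1 / (real K * 2 ^ (K - Suc k)) *
          (cmod (dyadic_gap (\<lambda>j. cdual_apply \<eta> (y j)) k m))\<^sup>2)"
  proof -
    have lin: "linear (cdual_apply \<eta>)"
      by (rule linear_cdual_apply)
    show ?thesis
      by (simp add: w_def z_def case_prod_unfold dyadic_gap_def linear_diff[OF lin]
          dyadic_mean_linear[OF lin])
  qed
  also have "\<dots> \<le> 4 / real K"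
    unfolding I_def
  proof (rule dyadic_gap_weighted_mean_square[OF _ \<open>0 < K\<close>])
    show "cmod (cdual_apply \<eta> (y j)) \<le> 1" for j
      using norm_cdual_apply_le_of_norm_le_1[OF \<eta>] y order_trans by blast
  qed
  finally show False
    using K \<open>0 < \<epsilon>\<close> \<open>0 < K\<close> by (simp add: field_simps)
qed

text \<open>
  A triangular array is built one pair at a time. Given finitely many pairs, Helly's theorem
  supplies a functional that annihilates the points found so far and is large at \<open>\<psi>\<close>; the next
  point is one of the range that is close to \<open>\<psi>\<close> at the new and at all old functionals.
\<close>

lemma cohen_weak_star_limit_in_space:
  fixes f :: "'e::complex_normed_vector \<Rightarrow> 'f::complex_banach"
  assumes "1 < p" and "cohen_strongly_summing p f U"
    and \<psi>: "cdual_apply \<psi> \<in> closure (evaluations ` f ` U)"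
  shows "\<psi> \<in> range bidual_embedding"
proof (rule ccontr)
  assume "\<psi> \<notin> range bidual_embedding"
  then obtain \<theta> where "0 < \<theta>" and \<theta>: "\<And>A. finite A \<Longrightarrow>
      \<exists>\<phi>. norm \<phi> \<le> 1 \<and> (\<forall>a\<in>A. cdual_apply \<phi> a = 0) \<and> \<theta> < Re (cdual_apply \<psi> \<phi>)"
    by (rule helly_outside_space) blast
  define X where "X = {(\<phi> :: 'f cdual, u). norm \<phi> \<le> 1 \<and> \<theta> < Re (cdual_apply \<psi> \<phi>) \<and> u \<in> U \<and>
    \<theta> \<le> Re (cdual_apply \<phi> (f u))}"
  define R where "R a b \<longleftrightarrow> \<theta> \<le> Re (cdual_apply (fst a) (f (snd b))) \<and> cdual_apply (fst b) (f (snd a)) = 0"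
    for a b :: "'f cdual \<times> 'e"
  have ex: "\<exists>x\<in>X. \<forall>y\<in>Y. R y x" if Y: "finite Y" "Y \<subseteq> X" for Y
  proof -
    obtain \<phi> where \<phi>: "norm \<phi> \<le> 1" "\<And>y. y \<in> Y \<Longrightarrow> cdual_apply \<phi> (f (snd y)) = 0" "\<theta> < Re (cdual_apply \<psi> \<phi>)"
      using \<theta>[of "(\<lambda>y. f (snd y)) ` Y"] Y(1) by auto
    define N where "N = (\<Inter>\<phi>'\<in>insert \<phi> (fst ` Y). {g. \<theta> < Re (g \<phi>')})"
    have "open N"
      unfolding N_def using Y(1)
      by (intro open_INT ballI open_Collect_less continuous_intros continuous_on_product_coordinates) auto
    moreover have "cdual_apply \<psi> \<in> N"
      using \<phi>(3) Y(2) by (auto simp: N_def X_def)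
    ultimately obtain u where "u \<in> U" "evaluations (f u) \<in> N"
      using \<psi> open_Int_closure_eq_empty[of N "evaluations ` f ` U"] by blast
    then have "(\<phi>, u) \<in> X" "\<forall>y\<in>Y. R y (\<phi>, u)"
      using \<phi> by (auto simp: N_def X_def R_def evaluations_def less_imp_le)
    then show ?thesis
      by blast
  qed
  have "\<exists>a :: nat \<Rightarrow> _. (\<forall>n. a n \<in> X) \<and> (\<forall>m n. m < n \<longrightarrow> R (a m) (a n))"
    using ex by (rule greedy_sequence)
  then obtain a :: "nat \<Rightarrow> 'f cdual \<times> 'e" where a: "\<forall>n. a n \<in> X" "\<forall>m n. m < n \<longrightarrow> R (a m) (a n)"
    by (elim exE conjE)
  show False
  proof (rule cohen_no_triangular_array[OF assms(1,2) \<open>0 < \<theta>\<close>, of "\<lambda>n. fst (a n)" "\<lambda>n. snd (a n)"])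
    show "norm (fst (a j)) \<le> 1" "snd (a j) \<in> U" for j
      using a(1)[rule_format, of j] by (auto simp: X_def case_prod_unfold)
    show "\<theta> \<le> Re (cdual_apply (fst (a j)) (f (snd (a n))))" if "j \<le> n" for j n
      using a(1)[rule_format, of j] a(2)[rule_format, of j n] that by (cases "j = n") (auto simp: X_def R_def case_prod_unfold)
    show "cdual_apply (fst (a j)) (f (snd (a n))) = 0" if "n < j" for j n
      using a(2)[rule_format, OF that] by (simp add: R_def)
  qed
qed

lemma cohen_range_relatively_weakly_compact:
  fixes f :: "'e::complex_normed_vector \<Rightarrow> 'f::complex_banach"
  assumes "1 < p" and "cohen_strongly_summing p f U"
  shows "relatively_weakly_compact (f ` U)"
proof -
  obtain r where r: "\<And>x. x \<in> U \<Longrightarrow> norm (f x) \<le> r"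
    using cohen_range_bounded[OF assms] by metis
  define B where "B = cdual_apply ` cball (0 :: 'f cdual cdual) r"
  have "compact B"
    unfolding B_def by (rule compact_dual_ball)
  have sub: "evaluations ` f ` U \<subseteq> B"
    using r by (auto simp: B_def evaluations_conv_bidual norm_bidual_embedding)
  then have cl: "closure (evaluations ` f ` U) \<subseteq> B"
    using \<open>compact B\<close> by (intro closure_minimal closed_if_compact_fun)
  show ?thesis
  proof (rule relatively_weakly_compactI[of "closure (evaluations ` f ` U)"])
    show "compact (closure (evaluations ` f ` U))"
      using compact_Int_closed[OF \<open>compact B\<close> closed_closure, of "evaluations ` f ` U"] cl
      by (simp add: Int_absorb1)
    show "closure (evaluations ` f ` U) \<subseteq> range evaluations"
    proof
      fix g assume g: "g \<in> closure (evaluations ` f ` U)"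
      then obtain \<psi> where "g = cdual_apply \<psi>"
        using cl by (auto simp: B_def)
      then show "g \<in> range evaluations"
        using cohen_weak_star_limit_in_space[OF assms] g by (auto simp: evaluations_conv_bidual)
    qed
    show "evaluations ` f ` U \<subseteq> closure (evaluations ` f ` U)"
      by (rule closure_subset)
  qed
qed

section \<open>Convex combinations of pointwise null sequences\<close>

definition bcontfun_max :: "('a::topological_space \<Rightarrow>\<^sub>C real) \<Rightarrow> ('a \<Rightarrow>\<^sub>C real) \<Rightarrow> ('a \<Rightarrow>\<^sub>C real)"
  where "bcontfun_max g h = Bcontfun (\<lambda>x. max (g x) (h x))"

lemma bcontfun_max_apply:
  fixes g h :: "'a::topological_space \<Rightarrow>\<^sub>C real"
  shows "bcontfun_max g h x = max (g x) (h x)"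
proof -
  have "(\<lambda>x. max (g x) (h x)) \<in> bcontfun"
  proof (rule bcontfun_normI)
    show "continuous_on UNIV (\<lambda>x. max (g x) (h x))"
      by (intro continuous_on_max continuous_on_apply_bcontfun)
    show "norm (max (g x) (h x)) \<le> max (norm g) (norm h)" for x
      using norm_bounded[of g x] norm_bounded[of h x] by auto
  qed
  then show ?thesis
    by (simp add: bcontfun_max_def Bcontfun_inverse)
qed

primrec partial_max :: "(nat \<Rightarrow> ('a::topological_space \<Rightarrow>\<^sub>C real)) \<Rightarrow> nat \<Rightarrow> nat \<Rightarrow> ('a \<Rightarrow>\<^sub>C real)" where
  "partial_max g k 0 = g k"
| "partial_max g k (Suc N) = bcontfun_max (partial_max g k N) (g (k + Suc N))"

lemma partial_max_ge:
  fixes g :: "nat \<Rightarrow> ('a::topological_space \<Rightarrow>\<^sub>C real)"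
  assumes "k \<le> n" and "n \<le> k + N"
  shows "g n x \<le> partial_max g k N x"
  using assms
proof (induction N)
  case (Suc N)
  then show ?case
    by (cases "n = k + Suc N") (auto simp: bcontfun_max_apply)
qed auto

lemma partial_max_attained:
  fixes g :: "nat \<Rightarrow> ('a::topological_space \<Rightarrow>\<^sub>C real)"
  shows "\<exists>n. k \<le> n \<and> n \<le> k + N \<and> partial_max g k N x = g n x"
proof (induction N)
  case (Suc N)
  then obtain n where n: "k \<le> n" "n \<le> k + N" "partial_max g k N x = g n x"
    by blast
  show ?case
  proof (cases "partial_max g k N x \<le> g (k + Suc N) x")
    case True
    then show ?thesis
      by (intro exI[of _ "k + Suc N"]) (simp add: bcontfun_max_apply)
  next
    case False
    then show ?thesis
      using n by (intro exI[of _ n]) (simp add: bcontfun_max_apply)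
  qed
qed auto

text \<open>
  The finite intersection property for the closed sets \<open>{x. c \<le> h j x}\<close>.
\<close>

lemma compact_superlevel_sequence:
  fixes h :: "nat \<Rightarrow> ('a::topological_space \<Rightarrow>\<^sub>C real)"
  assumes "compact K" and "\<And>k. \<exists>x\<in>K. \<forall>j\<le>k. c \<le> h j x"
  shows "\<exists>x\<in>K. \<forall>j. c \<le> h j x"
proof -
  define A where "A = range (\<lambda>j. {x. c \<le> h j x})"
  have "closed T" if "T \<in> A" for T
  proof -
    obtain j where "T = {x. c \<le> h j x}"
      using \<open>T \<in> A\<close> by (auto simp: A_def)
    then show ?thesis
      using closed_Collect_le[OF continuous_on_const continuous_on_apply_bcontfun] by blast
  qed
  moreover have "K \<inter> \<Inter>B \<noteq> {}" if B: "finite B" "B \<subseteq> A" for B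
  proof -
    obtain J where J: "finite J" "B = (\<lambda>j. {x. c \<le> h j x}) ` J"
      using finite_subset_image[OF B(1) B(2)[unfolded A_def]] by metis
    obtain x where "x \<in> K" "\<forall>j\<le>Max (insert 0 J). c \<le> h j x"
      using assms(2) by blast
    moreover have "j \<le> Max (insert 0 J)" if "j \<in> J" for j
      using J(1) that by (intro Max_ge) auto
    ultimately have "x \<in> K \<inter> \<Inter>B"
      using J(2) by auto
    then show ?thesis
      by blast
  qed
  ultimately have "K \<inter> \<Inter>A \<noteq> {}"
    using assms(1) unfolding compact_fip by metis
  then show ?thesis
    by (auto simp: A_def)
qed

text \<open>
  A form of Fatou's lemma for a functional \<open>L\<close> that is only finitely additive; compactness of
  \<open>K\<close> replaces countable additivity. For every \<open>k\<close> choose a maximum \<open>h k\<close> of finitely many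
  \<open>g n\<close> with \<open>n \<ge> k\<close> for which \<open>L\<close> is within \<open>e k\<close> of its supremum over such maxima. Then for
  \<open>j \<le> k\<close> the part of \<open>h k\<close> exceeding \<open>h j\<close> has \<open>L\<close>-value at most \<open>e j\<close>, so at some point of
  \<open>K\<close> all of \<open>h 0, \<dots>, h k\<close> are large at the same time.
\<close>

lemma positive_functional_limsup:
  fixes L :: "('a::topological_space \<Rightarrow>\<^sub>C real) \<Rightarrow> real" and g :: "nat \<Rightarrow> ('a \<Rightarrow>\<^sub>C real)"
  assumes "compact K" and L: "linear L" and sup: "\<And>(h :: 'a \<Rightarrow>\<^sub>C real) c. (\<And>x. x \<in> K \<Longrightarrow> apply_bcontfun h x \<le> c) \<Longrightarrow> L h \<le> c"
    and bound: "\<And>n x. x \<in> K \<Longrightarrow> g n x \<le> M" and "0 < \<epsilon>" and large: "\<And>n. \<epsilon> \<le> L (g n)"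
  shows "\<exists>x\<in>K. \<forall>k. \<exists>n\<ge>k. \<epsilon> / 4 \<le> g n x"
proof -
  have mono: "L h \<le> L h'" if "\<And>x. x \<in> K \<Longrightarrow> h x \<le> h' x" for h h' :: "'a \<Rightarrow>\<^sub>C real"
    using sup[of "h - h'" 0] that linear_diff[OF L, of h h'] by simp
  define e where "e j = \<epsilon> / 2 ^ (j + 2)" for j :: nat
  have e_pos: "0 < e j" for j
    using \<open>0 < \<epsilon>\<close> by (simp add: e_def)
  have sum_e: "(\<Sum>j<k. e j) \<le> \<epsilon> / 2" for k
  proof -
    have "(\<Sum>j<k. e j) = \<epsilon> / 2 - \<epsilon> / 2 ^ (k + 1)"
      by (induction k) (simp_all add: e_def field_simps)
    then show ?thesis
      using \<open>0 < \<epsilon>\<close> by simp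
  qed
  have "\<exists>N. \<forall>N'. L (partial_max g k N') \<le> L (partial_max g k N) + e k" for k
  proof -
    have "L (partial_max g k N) \<le> M" for N
    proof (rule sup)
      show "partial_max g k N x \<le> M" if "x \<in> K" for x
        using partial_max_attained[of k N g x] bound[OF that] by auto
    qed
    then have bdd: "bdd_above (range (\<lambda>N. L (partial_max g k N)))"
      by (intro bdd_aboveI2)
    then obtain N where N: "(SUP N. L (partial_max g k N)) - e k < L (partial_max g k N)"
      using less_cSUP_iff[OF _ bdd, of "(SUP N. L (partial_max g k N)) - e k"] e_pos[of k] by auto
    have "L (partial_max g k N') \<le> L (partial_max g k N) + e k" for N'
      using cSUP_upper[OF UNIV_I bdd, of N'] N by linarith
    then show ?thesis
      by blast
  qed
  then obtain N where N: "\<And>k N'. L (partial_max g k N') \<le> L (partial_max g k (N k)) + e k"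
    by metis
  define h where "h k = partial_max g k (N k)" for k
  have excess: "L (bcontfun_max (h j) (h k) - h j) \<le> e j" if "j \<le> k" for j k
  proof -
    have "L (bcontfun_max (h j) (h k)) \<le> L (partial_max g j (N j + (k - j) + N k))"
    proof (rule mono)
      fix x
      obtain m n where "j \<le> m" "m \<le> j + N j" "h j x = g m x" "k \<le> n" "n \<le> k + N k" "h k x = g n x"
        using partial_max_attained unfolding h_def by metis
      moreover from this have "g m x \<le> partial_max g j (N j + (k - j) + N k) x"
          "g n x \<le> partial_max g j (N j + (k - j) + N k) x"
        using \<open>j \<le> k\<close> by (intro partial_max_ge; simp)+
      ultimately show "bcontfun_max (h j) (h k) x \<le> partial_max g j (N j + (k - j) + N k) x"
        by (simp add: bcontfun_max_apply)
    qed
    also have "\<dots> \<le> L (h j) + e j"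
      unfolding h_def by (rule N)
    finally show ?thesis
      by (simp add: linear_diff[OF L])
  qed
  have "\<exists>x\<in>K. \<forall>j\<le>k. \<epsilon> / 4 \<le> h j x" for k
  proof -
    \<comment> \<open>D is large only where \<open>h k\<close> is large and no earlier \<open>h j\<close> falls much below it\<close>
    define D where "D = h k - (\<Sum>j<k. bcontfun_max (h j) (h k) - h j)"
    have "L (g k) \<le> L (h k)"
      unfolding h_def by (intro mono partial_max_ge) auto
    then have "\<epsilon> \<le> L (h k)"
      using large order_trans by blast
    moreover have "L (\<Sum>j<k. bcontfun_max (h j) (h k) - h j) \<le> (\<Sum>j<k. e j)"
      unfolding linear_sum[OF L] using excess by (intro sum_mono) simp
    ultimately have LD: "\<epsilon> / 2 \<le> L D"
      using sum_e[of k] by (simp add: D_def linear_diff[OF L])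
    obtain x where x: "x \<in> K" "\<epsilon> / 4 < D x"
    proof (rule ccontr)
      assume "\<not> thesis"
      then have "L D \<le> \<epsilon> / 4"
        using that by (intro sup) (metis not_less)
      then show False
        using LD \<open>0 < \<epsilon>\<close> by simp
    qed
    have apply_sum: "(\<Sum>j\<in>J. F j) x = (\<Sum>j\<in>J. F j x)" for F :: "nat \<Rightarrow> ('a \<Rightarrow>\<^sub>C real)" and J
      by (induction J rule: infinite_finite_induct) auto
    have D_x: "D x = h k x - (\<Sum>j<k. max (h j x) (h k x) - h j x)"
      by (simp add: D_def apply_sum bcontfun_max_apply)
    have "\<epsilon> / 4 \<le> h j x" if "j \<le> k" for j
    proof (cases "j = k")
      case True
      have "0 \<le> (\<Sum>j<k. max (h j x) (h k x) - h j x)"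
        by (intro sum_nonneg) simp
      then show ?thesis
        using x(2) D_x True by simp
    next
      case False
      then have "max (h j x) (h k x) - h j x \<le> (\<Sum>j<k. max (h j x) (h k x) - h j x)"
        using that by (intro member_le_sum) auto
      then show ?thesis
        using x(2) D_x by linarith
    qed
    then show ?thesis
      using x(1) by blast
  qed
  then obtain x where x: "x \<in> K" "\<And>j. \<epsilon> / 4 \<le> h j x"
    using compact_superlevel_sequence[OF \<open>compact K\<close>] by metis
  have "\<exists>n\<ge>k. \<epsilon> / 4 \<le> g n x" for k
    using partial_max_attained[of k "N k" g x] x(2)[of k] by (auto simp: h_def)
  then show ?thesis
    using x(1) by blast
qed

text \<open>
  If all convex combinations exceed \<open>\<epsilon>\<close> somewhere on \<open>K\<close>, the Mazur-Orlicz theorem, applied to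
  the supremum over \<open>K\<close>, yields a positive functional of mass \<open>1\<close> that is at least \<open>\<epsilon>\<close> on
  every \<open>g n\<close>. By the preceding lemma the \<open>g n\<close> cannot tend to \<open>0\<close> everywhere on \<open>K\<close>.
\<close>

lemma pointwise_null_convex_combination:
  fixes g :: "nat \<Rightarrow> ('a::topological_space \<Rightarrow>\<^sub>C real)"
  assumes K: "compact K" "K \<noteq> {}" and bound: "\<And>n. norm (g n) \<le> M"
    and null: "\<And>x. x \<in> K \<Longrightarrow> (\<lambda>n. g n x) \<longlonglongrightarrow> 0" and "0 < \<epsilon>"
  shows "\<exists>v\<in>convex hull (range g). \<forall>x\<in>K. v x \<le> \<epsilon>"
proof (rule ccontr)
  assume "\<not> ?thesis"
  then have large: "\<exists>x\<in>K. \<epsilon> < v x" if "v \<in> convex hull (range g)" for v :: "'a \<Rightarrow>\<^sub>C real"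
    using that by (metis not_less)
  define p where "p h = (SUP x\<in>K. apply_bcontfun h x)" for h :: "'a \<Rightarrow>\<^sub>C real"
  have bdd: "bdd_above (apply_bcontfun h ` K)" for h :: "'a \<Rightarrow>\<^sub>C real"
    using norm_bounded[of h] by (intro bdd_aboveI2[of _ _ "norm h"]) (metis abs_le_D1 real_norm_def)
  have le_p: "h x \<le> p h" if "x \<in> K" for h :: "'a \<Rightarrow>\<^sub>C real" and x
    unfolding p_def using that bdd by (rule cSUP_upper)
  have p_le: "p h \<le> c" if "\<And>x. x \<in> K \<Longrightarrow> h x \<le> c" for h :: "'a \<Rightarrow>\<^sub>C real" and c
    unfolding p_def using K(2) that by (rule cSUP_least)
  have "p (h + h') \<le> p h + p h'" for h h' :: "'a \<Rightarrow>\<^sub>C real"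
    using le_p by (intro p_le) (simp add: add_mono)
  moreover have "p (c *\<^sub>R h) = c * p h" if "0 \<le> c" for c and h :: "'a \<Rightarrow>\<^sub>C real"
  proof (cases "c = 0")
    case True
    have "p 0 = 0"
      using K(2) by (simp add: p_def)
    then show ?thesis
      using True by simp
  next
    case False
    have "p h \<le> p (c *\<^sub>R h) / c"
      using le_p[of _ "c *\<^sub>R h"] False that by (intro p_le) (simp add: field_simps)
    moreover have "p (c *\<^sub>R h) \<le> c * p h"
      using le_p that by (intro p_le) (simp add: mult_left_mono)
    ultimately show ?thesis
      using False that by (intro antisym) (simp_all add: field_simps)
  qed
  ultimately have "sublinear p"
    by (simp add: sublinear_def)
  define C where "C = (\<lambda>(t, v). (t *\<^sub>R v, t * \<epsilon>)) ` ({0..} \<times> (convex hull (range g)))"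
  have "convex_cone C"
    unfolding convex_cone_iff
  proof (intro conjI ballI allI impI)
    have "g 0 \<in> convex hull (range g)"
      by (simp add: hull_inc)
    then show "0 \<in> C"
      unfolding C_def by (intro image_eqI[of _ _ "(0, g 0)"]) (auto simp: zero_prod_def)
  next
    fix a b assume "a \<in> C" "b \<in> C"
    then obtain s t u v where st: "0 \<le> s" "0 \<le> t" and uv: "u \<in> convex hull (range g)" "v \<in> convex hull (range g)"
        and ab: "a = (s *\<^sub>R u, s * \<epsilon>)" "b = (t *\<^sub>R v, t * \<epsilon>)"
      by (auto simp: C_def)
    show "a + b \<in> C"
    proof (cases "s + t = 0")
      case True
      then have "s = 0" "t = 0"
        using st by auto
      then show ?thesis
        using uv ab unfolding C_def by (intro image_eqI[of _ _ "(0, u)"]) auto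
    next
      case False
      define w where "w = (s / (s + t)) *\<^sub>R u + (t / (s + t)) *\<^sub>R v"
      have "w \<in> convex hull (range g)"
        unfolding w_def using st uv False
        by (intro convexD[OF convex_convex_hull]) (auto simp: field_simps simp flip: add_divide_distrib)
      moreover have "a + b = ((s + t) *\<^sub>R w, (s + t) * \<epsilon>)"
      proof -
        have "(s + t) *\<^sub>R w = s *\<^sub>R u + t *\<^sub>R v"
          unfolding w_def scaleR_add_right scaleR_scaleR using False by simp
        then show ?thesis
          by (simp add: ab distrib_right)
      qed
      ultimately show ?thesis
        unfolding C_def using st by (intro image_eqI[of _ _ "(s + t, w)"]) auto
    qed
  next
    fix a and c :: real assume "a \<in> C" "0 \<le> c"
    then obtain t v where "0 \<le> t" "v \<in> convex hull (range g)" "a = (t *\<^sub>R v, t * \<epsilon>)"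
      by (auto simp: C_def)
    then show "c *\<^sub>R a \<in> C"
      unfolding C_def using \<open>0 \<le> c\<close> by (intro image_eqI[of _ _ "(c * t, v)"]) auto
  qed
  moreover have "r \<le> p w" if "(w, r) \<in> C" for w r
  proof -
    obtain t v where t: "0 \<le> t" and v: "v \<in> convex hull (range g)" and wr: "w = t *\<^sub>R v" "r = t * \<epsilon>"
      using \<open>(w, r) \<in> C\<close> by (auto simp: C_def)
    obtain x where "x \<in> K" "\<epsilon> < v x"
      using large[OF v] by blast
    then have "t * \<epsilon> \<le> (t *\<^sub>R v) x" "(t *\<^sub>R v) x \<le> p (t *\<^sub>R v)"
      using t le_p[of x "t *\<^sub>R v"] by (auto intro!: mult_left_mono)
    then show ?thesis
      by (simp add: wr)
  qed
  ultimately obtain L where L: "linear L" "\<And>h. L h \<le> p h" "\<And>w r. (w, r) \<in> C \<Longrightarrow> r \<le> L w"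
    using mazur_orlicz[OF \<open>sublinear p\<close>] by metis
  have "\<epsilon> \<le> L (g n)" for n
    using hull_inc[of "g n" "range g"]
    by (intro L(3)) (auto simp: C_def intro!: image_eqI[of _ _ "(1, g n)"])
  moreover have "g n x \<le> M" for n x
    using norm_bounded[of "g n" x] bound[of n] by simp
  moreover have "L h \<le> c" if "\<And>x. x \<in> K \<Longrightarrow> h x \<le> c" for h :: "'a \<Rightarrow>\<^sub>C real" and c
    using L(2) p_le[OF that] order_trans by blast
  ultimately obtain x where x: "x \<in> K" "\<And>k. \<exists>n\<ge>k. \<epsilon> / 4 \<le> g n x"
    using positive_functional_limsup[OF K(1) L(1) _ _ \<open>0 < \<epsilon>\<close>, of g M] by blast
  have "\<forall>\<^sub>F n in sequentially. g n x < \<epsilon> / 4"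
    using null[OF x(1)] \<open>0 < \<epsilon>\<close> by (intro order_tendstoD) auto
  then show False
    using x(2) by (auto simp: eventually_sequentially) (metis not_less)
qed

section \<open>Weakly convergent subsequences in the dual of a reflexive space\<close>

text \<open>
  The rational linear combinations of the sequence.
\<close>

lemma countable_subset_closure_subspace:
  fixes y :: "nat \<Rightarrow> 'a::real_normed_vector"
  obtains Q where "countable Q" "range y \<subseteq> Q" "subspace (closure Q)"
proof -
  define comb where "comb qs = (\<Sum>(q, k)\<leftarrow>qs. real_of_rat q *\<^sub>R y k)" for qs
  define Q where "Q = range comb"
  have Q_add: "u + v \<in> Q" if uv: "u \<in> Q" "v \<in> Q" for u v
  proof -
    obtain ps qs where "u = comb ps" "v = comb qs"
      using uv by (auto simp: Q_def)
    then have "u + v = comb (ps @ qs)"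
      by (simp add: comb_def)
    then show ?thesis
      by (simp add: Q_def)
  qed
  have Q_scale: "c *\<^sub>R u \<in> Q" if cu: "c \<in> \<rat>" "u \<in> Q" for c u
  proof -
    obtain q qs where "c = real_of_rat q" "u = comb qs"
      using cu by (auto simp: Q_def Rats_def)
    moreover have "real_of_rat q *\<^sub>R comb qs = comb (map (\<lambda>(p, k). (q * p, k)) qs)" for qs
      by (induction qs) (auto simp: comb_def scaleR_add_right of_rat_mult)
    ultimately show ?thesis
      by (simp add: Q_def)
  qed
  have "0 = comb []"
    by (simp add: comb_def)
  then have "0 \<in> Q"
    unfolding Q_def by blast
  have "subspace (closure Q)"
    unfolding subspace_def
  proof (intro conjI ballI allI)
    show "0 \<in> closure Q"
      using \<open>0 \<in> Q\<close> closure_subset by blast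
  next
    fix u v assume "u \<in> closure Q" "v \<in> closure Q"
    then obtain a b where a: "\<And>n. a n \<in> Q" "a \<longlonglongrightarrow> u" and b: "\<And>n. b n \<in> Q" "b \<longlonglongrightarrow> v"
      unfolding closure_sequential by metis
    then show "u + v \<in> closure Q"
      unfolding closure_sequential using Q_add[OF a(1) b(1)] tendsto_add[OF a(2) b(2)]
      by (intro exI[of _ "\<lambda>n. a n + b n"] conjI allI)
  next
    fix c :: real and u assume "u \<in> closure Q"
    then obtain a where a: "\<And>n. a n \<in> Q" "a \<longlonglongrightarrow> u"
      unfolding closure_sequential by metis
    obtain b where b: "\<And>n. b n \<in> \<rat>" "b \<longlonglongrightarrow> c"
      using Rats_closure_real closure_sequential[of c "\<rat> :: real set"] by auto
    show "c *\<^sub>R u \<in> closure Q"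
      unfolding closure_sequential using Q_scale[OF b(1) a(1)] tendsto_scaleR[OF b(2) a(2)]
      by (intro exI[of _ "\<lambda>n. b n *\<^sub>R a n"] conjI allI)
  qed
  moreover have "y k \<in> Q" for k
  proof -
    have "y k = comb [(1, k)]"
      by (simp add: comb_def)
    then show ?thesis
      by (simp add: Q_def)
  qed
  moreover have "countable Q"
    by (simp add: Q_def)
  ultimately show thesis
    using that by blast
qed

lemma almost_norming_point:
  fixes \<phi> :: "'a::complex_normed_vector cdual"
  shows "\<exists>x. norm x \<le> 1 \<and> norm \<phi> \<le> 2 * cmod (cdual_apply \<phi> x)"
proof (rule ccontr)
  assume no: "\<not> ?thesis"
  have less: "2 * cmod (cdual_apply \<phi> x) < norm \<phi>" if "norm x \<le> 1" for x
    using no that by (meson not_le)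
  have "0 < norm \<phi>"
    using less[of 0] by (simp add: linear_0[OF linear_cdual_apply])
  have "norm \<phi> \<le> norm \<phi> / 2"
  proof (rule norm_cdual_le)
    fix x :: 'a
    show "cmod (cdual_apply \<phi> x) \<le> norm \<phi> / 2 * norm x"
    proof (cases "x = 0")
      case True
      then show ?thesis
        by (simp add: linear_0[OF linear_cdual_apply])
    next
      case False
      then have "2 * cmod (cdual_apply \<phi> (inverse (norm x) *\<^sub>R x)) < norm \<phi>"
        by (intro less) simp
      then show ?thesis
        using False
        by (simp add: linear_cmul[OF linear_cdual_apply] field_simps)
    qed
  qed simp
  then show False
    using \<open>0 < norm \<phi>\<close> by simp
qed

text \<open>
  A cluster point is described by what is needed of it: a closed condition on the value at a
  single point that holds eventually along the sequence holds in the limit.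
\<close>

lemma weak_star_cluster_point:
  fixes v :: "nat \<Rightarrow> 'a::complex_normed_vector cdual"
  assumes "\<And>n. norm (v n) \<le> 1"
  shows "\<exists>\<phi>. \<forall>x A. closed A \<longrightarrow> (\<forall>\<^sub>F n in sequentially. cdual_apply (v n) x \<in> A) \<longrightarrow> cdual_apply \<phi> x \<in> A"
proof -
  define F where "F = filtermap (\<lambda>n. cdual_apply (v n)) sequentially"
  have "F \<noteq> bot"
    by (simp add: F_def filtermap_bot_iff)
  moreover have "\<forall>\<^sub>F g in F. g \<in> cdual_apply ` cball 0 1"
    using assms by (auto simp: F_def eventually_filtermap)
  ultimately obtain \<phi> where \<phi>: "inf (nhds (cdual_apply \<phi>)) F \<noteq> bot"
    using compact_dual_ball[where 'a = 'a, of 1] unfolding compact_filter by blast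
  have "cdual_apply \<phi> x \<in> A" if "closed A" and ev: "\<forall>\<^sub>F n in sequentially. cdual_apply (v n) x \<in> A" for x A
  proof (rule ccontr)
    assume "cdual_apply \<phi> x \<notin> A"
    have "open ((\<lambda>g. g x) -` (- A))"
      using \<open>closed A\<close> continuous_on_product_coordinates by (intro open_vimage) auto
    then have "\<forall>\<^sub>F g in nhds (cdual_apply \<phi>). g x \<notin> A"
      using \<open>cdual_apply \<phi> x \<notin> A\<close> eventually_nhds_in_open[of "(\<lambda>g. g x) -` (- A)"] by auto
    moreover have "\<forall>\<^sub>F g in F. g x \<in> A"
      using ev by (simp add: F_def eventually_filtermap)
    ultimately have "\<forall>\<^sub>F g in inf (nhds (cdual_apply \<phi>)) F. False"
      unfolding eventually_inf by blast
    then show False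
      using \<phi> by (simp add: trivial_limit_def)
  qed
  then show ?thesis
    by blast
qed

text \<open>
  Closed subspaces of the dual are closed in the weak topology of the dual, which for a
  reflexive space is the topology of pointwise convergence on the space.
\<close>

lemma reflexive_cluster_in_closed_subspace:
  fixes v :: "nat \<Rightarrow> 'a::complex_normed_vector cdual"
  assumes "reflexive_space TYPE('a)" and W: "subspace W" "closed W" and v: "\<And>n. v n \<in> W"
    and cluster: "\<And>x A. \<lbrakk>closed A; \<And>n. cdual_apply (v n) x \<in> A\<rbrakk> \<Longrightarrow> cdual_apply \<phi> x \<in> A"
  shows "\<phi> \<in> W"
proof (rule ccontr)
  assume "\<phi> \<notin> W"
  then obtain \<eta> where \<eta>: "\<And>w. w \<in> W \<Longrightarrow> Re (cdual_apply \<eta> w) = 0" "Re (cdual_apply \<eta> \<phi>) \<noteq> 0"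
    using functional_separating_subspace[OF W(1), of \<phi>] W(2) by auto
  obtain x where "\<eta> = bidual_embedding x"
    using assms(1) unfolding reflexive_space_def by (metis surjD)
  then have "cdual_apply \<phi> x \<in> {c. Re c = 0}"
    using \<eta>(1) v by (intro cluster closed_Collect_eq continuous_intros) (simp add: bidual_embedding_apply)
  then show False
    using \<eta>(2) \<open>\<eta> = bidual_embedding x\<close> by (simp add: bidual_embedding_apply)
qed

text \<open>
  The Eberlein-Smulian theorem for the dual of a reflexive space. Let \<open>Q\<close> consist of the
  rational combinations of the sequence, and choose for each member of \<open>Q\<close> a point at which it
  attains at least half of its norm. A diagonal subsequence converges at these countably many
  points. All its cluster points lie in the closure of \<open>Q\<close> and agree at the chosen points,
  which determine the norm up to a factor on that closure; hence there is only one cluster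
  point, and by compactness the subsequence converges to it.
\<close>

lemma reflexive_bounded_sequence_weakly_convergent_subsequence:
  fixes y :: "nat \<Rightarrow> 'a::complex_normed_vector cdual"
  assumes refl: "reflexive_space TYPE('a)" and y: "\<And>n. norm (y n) \<le> 1"
  shows "\<exists>r. strict_mono (r :: nat \<Rightarrow> nat) \<and> (\<forall>x. convergent (\<lambda>n. cdual_apply (y (r n)) x))"
proof -
  obtain Q where Q: "countable Q" "range y \<subseteq> Q" "subspace (closure Q)"
    by (rule countable_subset_closure_subspace)
  obtain peak :: "'a cdual \<Rightarrow> 'a"
    where peak: "\<And>\<phi>. norm (peak \<phi>) \<le> 1" "\<And>\<phi>. norm \<phi> \<le> 2 * cmod (cdual_apply \<phi> (peak \<phi>))"
    using almost_norming_point by metis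
  have "cmod (cdual_apply (y n) x) \<le> 1" if "x \<in> peak ` Q" for n x
    using norm_cdual_apply_le_of_norm_le_1[OF y] peak(1) that order_trans by blast
  then obtain r where r: "strict_mono (r :: nat \<Rightarrow> nat)"
      and conv: "\<And>x. x \<in> peak ` Q \<Longrightarrow> \<exists>l. (\<lambda>n. cdual_apply (y (r n)) x) \<longlonglongrightarrow> l"
    using function_convergent_subsequence[of "peak ` Q" "\<lambda>n. cdual_apply (y n)" 1] Q(1)
    by (metis countable_image)
  define cluster where "cluster v \<phi> \<longleftrightarrow> (\<forall>x A. closed A \<longrightarrow>
      (\<forall>\<^sub>F n in sequentially. cdual_apply (v n) x \<in> A) \<longrightarrow> cdual_apply \<phi> x \<in> A)"
    for v :: "nat \<Rightarrow> 'a cdual" and \<phi>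
  have clusterD: "cdual_apply \<phi> x \<in> A"
    if "cluster v \<phi>" "closed A" "\<forall>\<^sub>F n in sequentially. cdual_apply (v n) x \<in> A" for v \<phi> x A
    using that by (simp add: cluster_def)
  have cluster_ex: "\<exists>\<phi>. cluster (\<lambda>n. y (s n)) \<phi>" for s
    unfolding cluster_def by (intro weak_star_cluster_point y)
  have cluster_W: "\<phi> \<in> closure Q" if "cluster (\<lambda>n. y (s n)) \<phi>" for s \<phi>
  proof (rule reflexive_cluster_in_closed_subspace[OF refl Q(3) closed_closure])
    show "y (s n) \<in> closure Q" for n
      using Q(2) closure_subset by blast
    show "cdual_apply \<phi> x \<in> A" if "closed A" "\<And>n. cdual_apply (y (s n)) x \<in> A" for x A
      using that clusterD[OF \<open>cluster (\<lambda>n. y (s n)) \<phi>\<close> that(1)] by simp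
  qed
  have cluster_lim: "cdual_apply \<phi> x = l"
    if "cluster v \<phi>" and lim: "(\<lambda>n. cdual_apply (v n) x) \<longlonglongrightarrow> l" for v \<phi> x l
  proof -
    have "dist (cdual_apply \<phi> x) l \<le> e" if "0 < e" for e
    proof -
      have "\<forall>\<^sub>F n in sequentially. dist (cdual_apply (v n) x) l < e"
        using lim \<open>0 < e\<close> by (rule tendstoD)
      then have "\<forall>\<^sub>F n in sequentially. cdual_apply (v n) x \<in> cball l e"
        by (rule eventually_mono) (simp add: dist_commute)
      then have "cdual_apply \<phi> x \<in> cball l e"
        by (rule clusterD[OF \<open>cluster v \<phi>\<close> closed_cball])
      then show ?thesis
        by (simp add: dist_commute)
    qed
    then show ?thesis
      using field_le_epsilon[of "dist (cdual_apply \<phi> x) l" 0] by simp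
  qed
  have unique: "\<phi> = \<phi>'"
    if "cluster (\<lambda>n. y (r n)) \<phi>" "cluster (\<lambda>n. y (r (r' n))) \<phi>'" "strict_mono r'" for \<phi> \<phi>' r'
  proof -
    have agree: "cdual_apply (\<phi> - \<phi>') x = 0" if x: "x \<in> peak ` Q" for x
    proof -
      obtain l where l: "(\<lambda>n. cdual_apply (y (r n)) x) \<longlonglongrightarrow> l"
        using conv[OF x] by blast
      then have "(\<lambda>n. cdual_apply (y (r (r' n))) x) \<longlonglongrightarrow> l"
        using LIMSEQ_subseq_LIMSEQ[OF l \<open>strict_mono r'\<close>] by (simp add: o_def)
      then show ?thesis
        using cluster_lim[OF \<open>cluster (\<lambda>n. y (r n)) \<phi>\<close> l]
          cluster_lim[OF \<open>cluster (\<lambda>n. y (r (r' n))) \<phi>'\<close>] by (simp add: cdual_apply_minus)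
    qed
    have "\<phi> - \<phi>' \<in> closure Q"
      using cluster_W[OF that(1)] cluster_W[OF that(2)] Q(3) subspace_diff by blast
    have "norm (\<phi> - \<phi>') \<le> e" if "0 < e" for e
    proof -
      obtain q where "q \<in> Q" and q: "dist q (\<phi> - \<phi>') < e / 3"
        using \<open>\<phi> - \<phi>' \<in> closure Q\<close> \<open>0 < e\<close> unfolding closure_approachable
        by (metis divide_pos_pos zero_less_numeral)
      have "norm q \<le> 2 * cmod (cdual_apply (q - (\<phi> - \<phi>')) (peak q))"
        using peak(2)[of q] agree[of "peak q"] \<open>q \<in> Q\<close> by (simp add: cdual_apply_minus)
      also have "cmod (cdual_apply (q - (\<phi> - \<phi>')) (peak q)) \<le> norm (q - (\<phi> - \<phi>')) * 1"
        using norm_cdual_apply_le mult_left_mono[OF peak(1)] norm_ge_zero order_trans by blast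
      finally have "norm q \<le> 2 * (e / 3)"
        using q by (simp add: dist_norm)
      moreover have "norm (\<phi> - \<phi>') \<le> norm q + norm (q - (\<phi> - \<phi>'))"
        by (metis norm_minus_commute norm_triangle_sub)
      ultimately show ?thesis
        using q by (simp add: dist_norm)
    qed
    then show ?thesis
      using field_le_epsilon[of "norm (\<phi> - \<phi>')" 0] by simp
  qed
  obtain \<phi> where \<phi>: "cluster (\<lambda>n. y (r n)) \<phi>"
    using cluster_ex by blast
  have "(\<lambda>n. cdual_apply (y (r n)) x) \<longlonglongrightarrow> cdual_apply \<phi> x" for x
  proof (rule ccontr)
    assume "\<not> ?thesis"
    then obtain e where "0 < e" and e: "\<And>N. \<exists>n\<ge>N. e \<le> dist (cdual_apply (y (r n)) x) (cdual_apply \<phi> x)"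
      unfolding lim_sequentially by (metis not_less)
    then have "infinite {n. e \<le> dist (cdual_apply (y (r n)) x) (cdual_apply \<phi> x)}"
      unfolding infinite_nat_iff_unbounded_le by blast
    \<comment> \<open>a subsequence that stays away from the limit has a cluster point different from
      \<open>\<phi>\<close>\<close>
    from infinite_enumerate[OF this] obtain r' :: "nat \<Rightarrow> nat" where "strict_mono r'"
        and r': "\<forall>n. e \<le> dist (cdual_apply (y (r (r' n))) x) (cdual_apply \<phi> x)"
      by auto
    obtain \<phi>' where \<phi>': "cluster (\<lambda>n. y (r (r' n))) \<phi>'"
      using cluster_ex[of "\<lambda>n. r (r' n)"] by blast
    have "closed {c. e \<le> dist c (cdual_apply \<phi> x)}"
      by (intro closed_Collect_le continuous_intros)
    then have "cdual_apply \<phi>' x \<in> {c. e \<le> dist c (cdual_apply \<phi> x)}"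
      using r' by (intro clusterD[OF \<phi>']) simp_all
    then show False
      using unique[OF \<phi> \<phi>' \<open>strict_mono r'\<close>] \<open>0 < e\<close> by simp
  qed
  then show ?thesis
    using r convergentI by blast
qed

section \<open>Relative compactness of the range in a reflexive space\<close>

text \<open>
  The duality between compactness of an operator and of its transpose. A finite net of the
  dual ball for the uniform distance on the range determines norms of differences of points of
  the range up to \<open>2 \<delta>\<close>, and a sequence in the range has a subsequence that converges at the
  members of the net.
\<close>

lemma precompact_if_functionals_precompact:
  fixes f :: "'u \<Rightarrow> 'a::complex_banach"
  assumes bound: "\<And>u. u \<in> U \<Longrightarrow> norm (f u) \<le> r"
    and nets: "\<And>\<delta>. 0 < \<delta> \<Longrightarrow> \<exists>Y. finite Y \<and> Y \<subseteq> cball 0 1 \<and>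
      (\<forall>\<phi>\<in>cball 0 1. \<exists>\<psi>\<in>Y. \<forall>u\<in>U. cmod (cdual_apply (\<phi> - \<psi>) (f u)) < \<delta>)"
  shows "relatively_compact (f ` U)"
  unfolding relatively_compact_def compact_eq_totally_bounded
proof (intro conjI allI impI)
  show "complete (closure (f ` U))"
    by (simp add: complete_eq_closed)
next
  fix e :: real assume "0 < e"
  show "\<exists>k. finite k \<and> closure (f ` U) \<subseteq> (\<Union>x\<in>k. ball x e)"
  proof (rule ccontr)
    assume no_net: "\<not> ?thesis"
    have ex: "\<exists>u\<in>U. \<forall>v\<in>V. e / 2 < dist (f v) (f u)" if V: "finite V" "V \<subseteq> U" for V
    proof (rule ccontr)
      assume "\<not> ?thesis"
      then have "f ` U \<subseteq> (\<Union>x\<in>f ` V. cball x (e / 2))"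
        by (force simp: not_less)
      moreover have "closed (\<Union>x\<in>f ` V. cball x (e / 2))"
        using V(1) by (intro closed_UN) auto
      ultimately have "closure (f ` U) \<subseteq> (\<Union>x\<in>f ` V. cball x (e / 2))"
        by (rule closure_minimal)
      also have "\<dots> \<subseteq> (\<Union>x\<in>f ` V. ball x e)"
        using \<open>0 < e\<close> by fastforce
      finally show False
        using no_net V(1) by blast
    qed
    have "\<exists>s :: nat \<Rightarrow> 'u. (\<forall>n. s n \<in> U) \<and> (\<forall>m n. m < n \<longrightarrow> e / 2 < dist (f (s m)) (f (s n)))"
      using ex by (rule greedy_sequence)
    then obtain s :: "nat \<Rightarrow> 'u" where s: "\<And>n. s n \<in> U"
        and sep: "\<forall>m n. m < n \<longrightarrow> e / 2 < dist (f (s m)) (f (s n))"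
      by blast
    \<comment> \<open>three errors of size \<open>\<delta>\<close> must not exceed half of e\<close>
    define \<delta> where "\<delta> = e / 6"
    have "0 < \<delta>"
      using \<open>0 < e\<close> by (simp add: \<delta>_def)
    from nets[OF this] obtain Y where Y: "finite Y" "Y \<subseteq> cball 0 1"
        "\<forall>\<phi>\<in>cball 0 1. \<exists>\<psi>\<in>Y. \<forall>u\<in>U. cmod (cdual_apply (\<phi> - \<psi>) (f u)) < \<delta>"
      by (elim exE conjE)
    have "cmod (cdual_apply \<psi> (f (s n))) \<le> r" if "\<psi> \<in> Y" for n \<psi>
    proof -
      have "cmod (cdual_apply \<psi> (f (s n))) \<le> norm (f (s n))"
        using Y(2) that by (intro norm_cdual_apply_le_of_norm_le_1) auto
      then show ?thesis
        using bound s order_trans by blast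
    qed
    then obtain k where k: "strict_mono (k :: nat \<Rightarrow> nat)"
        "\<And>\<psi>. \<psi> \<in> Y \<Longrightarrow> \<exists>l. (\<lambda>n. cdual_apply \<psi> (f (s (k n)))) \<longlonglongrightarrow> l"
      using function_convergent_subsequence[of Y "\<lambda>n \<psi>. cdual_apply \<psi> (f (s n))" r] Y(1)
      by (metis countable_finite)
    have "\<forall>\<^sub>F n in sequentially. cmod (cdual_apply \<psi> (f (s (k n)) - f (s (k (Suc n))))) < \<delta>" if \<psi>: "\<psi> \<in> Y" for \<psi>
    proof -
      obtain l where l: "(\<lambda>n. cdual_apply \<psi> (f (s (k n)))) \<longlonglongrightarrow> l"
        using k(2)[OF \<psi>] by blast
      then have "(\<lambda>n. cdual_apply \<psi> (f (s (k n))) - cdual_apply \<psi> (f (s (k (Suc n))))) \<longlonglongrightarrow> l - l"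
        by (intro tendsto_diff LIMSEQ_Suc)
      then have "\<forall>\<^sub>F n in sequentially.
          dist (cdual_apply \<psi> (f (s (k n))) - cdual_apply \<psi> (f (s (k (Suc n))))) 0 < \<delta>"
        using \<open>0 < \<delta>\<close> by (intro tendstoD) simp_all
      then show ?thesis
        by (simp add: linear_diff[OF linear_cdual_apply])
    qed
    then have "\<forall>\<^sub>F n in sequentially. \<forall>\<psi>\<in>Y. cmod (cdual_apply \<psi> (f (s (k n)) - f (s (k (Suc n))))) < \<delta>"
      using Y(1) by (intro eventually_ball_finite) auto
    then obtain n where n: "\<forall>\<psi>\<in>Y. cmod (cdual_apply \<psi> (f (s (k n)) - f (s (k (Suc n))))) < \<delta>"
      by (auto dest!: eventually_happens)
    have "norm (f (s (k n)) - f (s (k (Suc n)))) \<le> e / 2"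
    proof (rule norm_le_if_functionals_le)
      fix \<phi> :: "'a cdual" assume "norm \<phi> \<le> 1"
      then obtain \<psi> where "\<psi> \<in> Y" and \<psi>: "\<And>u. u \<in> U \<Longrightarrow> cmod (cdual_apply (\<phi> - \<psi>) (f u)) < \<delta>"
        using bspec[OF Y(3), of \<phi>] by auto
      define a b where "a = f (s (k n))" and "b = f (s (k (Suc n)))"
      have "cdual_apply \<phi> (a - b) =
          cdual_apply (\<phi> - \<psi>) a - cdual_apply (\<phi> - \<psi>) b + cdual_apply \<psi> (a - b)"
        by (simp add: cdual_apply_minus linear_diff[OF linear_cdual_apply])
      then have "cmod (cdual_apply \<phi> (a - b)) \<le>
          cmod (cdual_apply (\<phi> - \<psi>) a) + cmod (cdual_apply (\<phi> - \<psi>) b) + cmod (cdual_apply \<psi> (a - b))"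
        by (metis add_right_mono norm_triangle_ineq norm_triangle_ineq4 order_trans)
      moreover have "cmod (cdual_apply (\<phi> - \<psi>) a) < \<delta>" "cmod (cdual_apply (\<phi> - \<psi>) b) < \<delta>"
        unfolding a_def b_def by (intro \<psi> s)+
      moreover have "cmod (cdual_apply \<psi> (a - b)) < \<delta>"
        using n \<open>\<psi> \<in> Y\<close> by (simp add: a_def b_def)
      ultimately show "cmod (cdual_apply \<phi> (f (s (k n)) - f (s (k (Suc n))))) \<le> e / 2"
        by (simp add: \<delta>_def a_def b_def)
    qed
    moreover have "e / 2 < dist (f (s (k n))) (f (s (k (Suc n))))"
      using sep k(1) by (simp add: strict_mono_Suc_iff)
    ultimately show False
      by (simp add: dist_norm)
  qed
qed

text \<open>
  The convex combination of the functions \<open>h \<mapsto> \<bar>h (z n)\<bar>\<^sup>2\<close> that is small on the bidual ball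
  provides the weights for the mean square estimate. Truncation at \<open>4\<close> makes these functions
  bounded on the whole function space and does not change them on the ball, where
  \<open>\<bar>h (z n)\<bar> \<le> 2\<close>.
\<close>

lemma cohen_no_pointwise_null_sequence:
  fixes f :: "'e::complex_normed_vector \<Rightarrow> 'f::complex_normed_vector"
  assumes "1 < p" and "cohen_strongly_summing p f U" and "0 < \<delta>"
    and z: "\<And>n :: nat. norm (z n) \<le> 2" and t: "\<And>n. t n \<in> U"
    and large: "\<And>n. \<delta> \<le> cmod (cdual_apply (z n) (f (t n)))"
    and null: "\<And>\<eta>. (\<lambda>n. cdual_apply \<eta> (z n)) \<longlonglongrightarrow> 0"
  shows False
proof -
  obtain \<epsilon> where "0 < \<epsilon>" and \<epsilon>: "\<And>(I :: nat set) w z t. finite I \<and> sum w I = 1 \<and>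
    (\<forall>i\<in>I. 0 \<le> w i \<and> t i \<in> U \<and> norm (z i) \<le> 2 \<and> \<delta> \<le> cmod (cdual_apply (z i) (f (t i))))
    \<Longrightarrow> (\<exists>\<eta>. norm \<eta> \<le> 1 \<and> \<epsilon> < (\<Sum>i\<in>I. w i * (cmod (cdual_apply \<eta> (z i)))\<^sup>2))"
    using cohen_mean_square_lower_bound[OF assms(1-3), where 'i = nat] by blast
  define B where "B = cdual_apply ` cball (0 :: 'f cdual cdual) 1"
  define g where "g n = Bcontfun (\<lambda>h :: 'f cdual \<Rightarrow> complex. min 4 ((cmod (h (z n)))\<^sup>2))" for n
  have g: "apply_bcontfun (g n) h = min 4 ((cmod (h (z n)))\<^sup>2)" for n h
  proof -
    have "(\<lambda>h :: 'f cdual \<Rightarrow> complex. min 4 ((cmod (h (z n)))\<^sup>2)) \<in> bcontfun"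
      by (rule bcontfun_normI[where b = 4])
        (auto intro!: continuous_on_min continuous_intros continuous_on_product_coordinates)
    then show ?thesis
      by (simp add: g_def Bcontfun_inverse)
  qed
  have g_B: "apply_bcontfun (g n) (cdual_apply \<eta>) = (cmod (cdual_apply \<eta> (z n)))\<^sup>2" if "norm \<eta> \<le> 1" for n \<eta>
  proof -
    have "cmod (cdual_apply \<eta> (z n)) \<le> 2"
      using norm_cdual_apply_le_of_norm_le_1[OF that] z order_trans by blast
    then have "(cmod (cdual_apply \<eta> (z n)))\<^sup>2 \<le> 2\<^sup>2"
      by (intro power_mono) auto
    then show ?thesis
      by (simp add: g)
  qed
  have "\<exists>v\<in>convex hull (range g). \<forall>h\<in>B. apply_bcontfun v h \<le> \<epsilon>"
  proof (rule pointwise_null_convex_combination)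
    show "compact B" "B \<noteq> {}"
      by (auto simp: B_def compact_dual_ball)
    show "norm (g n) \<le> 4" for n
      by (rule norm_bound) (simp add: g)
    show "0 < \<epsilon>" by fact
    fix h assume "h \<in> B"
    then obtain \<eta> where "h = cdual_apply \<eta>" "norm \<eta> \<le> 1"
      by (auto simp: B_def)
    then show "(\<lambda>n. apply_bcontfun (g n) h) \<longlonglongrightarrow> 0"
      using tendsto_power[OF tendsto_norm[OF null[of \<eta>]], of 2] by (simp add: g_B)
  qed
  then obtain v where v: "v \<in> convex hull (range g)" "\<And>h. h \<in> B \<Longrightarrow> apply_bcontfun v h \<le> \<epsilon>"
    by blast
  from v(1) obtain k u x where ux: "\<forall>i\<in>{1::nat..k}. 0 \<le> u i \<and> x i \<in> range g"
      and u1: "sum u {1..k} = 1" and xv: "(\<Sum>i=1..k. u i *\<^sub>R x i) = v"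
    unfolding convex_hull_indexed mem_Collect_eq by (elim exE conjE)
  have "\<forall>i\<in>{1..k}. \<exists>n. x i = g n"
    using ux by blast
  then obtain m where m: "\<forall>i\<in>{1..k}. x i = g (m i)"
    by (rule bchoice[THEN exE])
  obtain \<eta> where \<eta>: "norm \<eta> \<le> 1" "\<epsilon> < (\<Sum>i=1..k. u i * (cmod (cdual_apply \<eta> (z (m i))))\<^sup>2)"
    using \<epsilon>[of "{1..k}" u "\<lambda>i. t (m i)" "\<lambda>i. z (m i)"] ux u1 t z large by auto
  have apply_sum: "apply_bcontfun (\<Sum>i\<in>J. u i *\<^sub>R x i) h = (\<Sum>i\<in>J. u i * apply_bcontfun (x i) h)" for J h
    by (induction J rule: infinite_finite_induct) auto
  have "(\<Sum>i=1..k. u i * (cmod (cdual_apply \<eta> (z (m i))))\<^sup>2) = apply_bcontfun v (cdual_apply \<eta>)"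
    unfolding xv[symmetric] apply_sum using m g_B[OF \<eta>(1)] by simp
  also have "\<dots> \<le> \<epsilon>"
    using \<eta>(1) by (intro v(2)) (auto simp: B_def)
  finally show False
    using \<eta>(2) by simp
qed

lemma cohen_reflexive_range_relatively_compact:
  fixes f :: "'e::complex_normed_vector \<Rightarrow> 'f::complex_banach"
  assumes "1 < p" and "cohen_strongly_summing p f U" and refl: "reflexive_space TYPE('f)"
  shows "relatively_compact (f ` U)"
proof -
  obtain r where r: "\<And>u. u \<in> U \<Longrightarrow> norm (f u) \<le> r"
    using cohen_range_bounded[OF assms(1,2)] by metis
  show ?thesis
  proof (rule precompact_if_functionals_precompact[OF r], assumption, rule ccontr)
    fix \<delta> :: real
    assume "0 < \<delta>"
      and no_net: "\<nexists>Y. finite Y \<and> Y \<subseteq> cball 0 1 \<and>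
        (\<forall>\<phi>\<in>cball 0 1. \<exists>\<psi>\<in>Y. \<forall>u\<in>U. cmod (cdual_apply (\<phi> - \<psi>) (f u)) < \<delta>)"
    have ex: "\<exists>\<phi>\<in>cball 0 1. \<forall>\<psi>\<in>Y. \<exists>u\<in>U. \<delta> \<le> cmod (cdual_apply (\<phi> - \<psi>) (f u))"
      if "finite Y" "Y \<subseteq> cball 0 1" for Y
      using no_net that by (meson not_less)
    have "\<exists>y :: nat \<Rightarrow> 'f cdual. (\<forall>n. y n \<in> cball 0 1) \<and>
        (\<forall>m n. m < n \<longrightarrow> (\<exists>u\<in>U. \<delta> \<le> cmod (cdual_apply (y n - y m) (f u))))"
      using ex by (rule greedy_sequence)
    then obtain y :: "nat \<Rightarrow> 'f cdual" where y: "\<And>n. norm (y n) \<le> 1"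
        and sep: "\<forall>m n. m < n \<longrightarrow> (\<exists>u\<in>U. \<delta> \<le> cmod (cdual_apply (y n - y m) (f u)))"
      by auto
    obtain k where k: "strict_mono (k :: nat \<Rightarrow> nat)" and conv: "\<And>x. convergent (\<lambda>n. cdual_apply (y (k n)) x)"
      using reflexive_bounded_sequence_weakly_convergent_subsequence[OF refl, of y] y by blast
    define z where "z n = y (k (Suc n)) - y (k n)" for n
    have "\<exists>u\<in>U. \<delta> \<le> cmod (cdual_apply (z n) (f u))" for n
      using sep k by (simp add: z_def strict_mono_Suc_iff)
    then obtain t where t: "\<And>n. t n \<in> U" "\<And>n. \<delta> \<le> cmod (cdual_apply (z n) (f (t n)))"
      by metis
    show False
    proof (rule cohen_no_pointwise_null_sequence[OF assms(1,2) \<open>0 < \<delta>\<close> _ t])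
      show "norm (z n) \<le> 2" for n
        using norm_triangle_ineq4[of "y (k (Suc n))" "y (k n)"] y[of "k (Suc n)"] y[of "k n"]
        by (simp add: z_def)
      fix \<eta> :: "'f cdual cdual"
      obtain x where x: "\<eta> = bidual_embedding x"
        using refl unfolding reflexive_space_def by (metis surjD)
      obtain l where l: "(\<lambda>n. cdual_apply (y (k n)) x) \<longlonglongrightarrow> l"
        using conv unfolding convergent_def by blast
      have "(\<lambda>n. cdual_apply (y (k (Suc n))) x - cdual_apply (y (k n)) x) \<longlonglongrightarrow> l - l"
        using l by (intro tendsto_diff LIMSEQ_Suc)
      then show "(\<lambda>n. cdual_apply \<eta> (z n)) \<longlonglongrightarrow> 0"
        by (simp add: x z_def bidual_embedding_apply cdual_apply_minus)
    qed
  qed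
qed

section \<open>Compactness of the range\<close>

theorem corollary5p10:
  fixes U :: "'e::complex_banach set"
    and p :: ereal
  assumes "open U" and "1 < p" and "p \<le> \<infinity>"
  shows "(\<forall>f :: 'e \<Rightarrow> 'f::complex_banach.
            holomorphic_map_on f U \<and> cohen_strongly_summing p f U \<longrightarrow>
            relatively_weakly_compact (f ` U)) \<and>
         (reflexive_space TYPE('f) \<longrightarrow>
           (\<forall>f :: 'e \<Rightarrow> 'f.
              holomorphic_map_on f U \<and> cohen_strongly_summing p f U \<longrightarrow>
              relatively_compact (f ` U)))"
proof (intro conjI impI allI)
  fix f :: "'e \<Rightarrow> 'f"
  assume "holomorphic_map_on f U \<and> cohen_strongly_summing p f U"
  then show "relatively_weakly_compact (f ` U)"
    using cohen_range_relatively_weakly_compact[OF \<open>1 < p\<close>] by blast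
next
  fix f :: "'e \<Rightarrow> 'f"
  assume "reflexive_space TYPE('f)"
    and "holomorphic_map_on f U \<and> cohen_strongly_summing p f U"
  then show "relatively_compact (f ` U)"
    using cohen_reflexive_range_relatively_compact[OF \<open>1 < p\<close>] by blast
qed

end
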